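(* Let $\mathfrak{g}$ be a finite-dimensional real Lie algebra, let $\mathcal{D}\subseteq C^\infty(\mathfrak{g}^* )$ be a subspace such that $\mathcal{D}[[\nu]]$ is a two-sided ideal of $(C^\infty(\mathfrak{g}^* )[[\nu]],\star_{BCH})$, and let $\tau=\sum_{r\ge0}\nu^r\tau_r$ be a $\mathbb{R}[[\nu]]$-linear functional on $\mathcal{D}[[\nu]]$ (with linear $\tau_r:\mathcal{D}\to\mathbb{R}$) satisfying the continuity property: for every $f\in C^\infty(\mathfrak{g}^* )$, $g\in\mathcal{D}$ and every sequence of polynomials $p_m\in\mathrm{Pol}^\bullet(\mathfrak{g}^* )$ with $p_m\to f$ in the $C^\infty$ (locally convex) topology, one has $\tau_r([p_m,g]_{\star_{BCH}})\to\tau_r([f,g]_{\star_{BCH}})$ in each order of $\nu$. Then the following are equivalent: (i) $\tau$ is a $\star_{BCH}$-trace on $\mathcal{D}[[\nu]]$, i.e. $\tau(f\star_{BCH}g-g\star_{BCH}f)=0$ for all $f\in C^\infty(\mathfrak{g}^* )[[\nu]]$, $g\in\mathcal{D}[[\nu]]$; (ii) each $\tau_r$ is a Poisson trace on $\mathcal{D}$, i.e. $\tau_r(\{f,g\})=0$ for all $f\in C^\infty(\mathfrak{g}^* )$, $g\in\mathcal{D}$; (iii) each $\tau_r$ is $\mathfrak{g}$-invariant, i.e. $\tau_r(\{\hat x,g\})=0$ for all $x\in\mathfrak{g}$, $g\in\mathcal{D}$.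
   Context: $\{f,g\}=\xi_kc^k_{ij}\partial_{\xi_i}f\,\partial_{\xi_j}g$ is the linear Poisson bracket on $\mathfrak{g}^*$ ($c^k_{ij}$ structure constants), $\hat x(\xi)=\xi(x)$, and $[f,g]_{\star}=f\star g-g\star f$. The BCH star product $\star_{BCH}$ is the unique differential star product on $C^\infty(\mathfrak{g}^* )[[\nu]]$ such that on polynomials $\sigma_\nu(f\star_{BCH}g)=\sigma_\nu(f)\bullet\sigma_\nu(g)$, where $\bullet$ is the product in $\mathcal U(\mathfrak g)$ and $\sigma_\nu(\hat x_1\cdots\hat x_k)=\frac{\nu^k}{k!}\sum_{\tau\in S_k}x_{\tau(1)}\bullet\cdots\bullet x_{\tau(k)}$. It satisfies $\hat x\star_{BCH}f-f\star_{BCH}\hat x=\nu\{\hat x,f\}$ for all $x\in\mathfrak g$ and all $f$. *)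

theory Defs
  imports "HOL-Analysis.Analysis" "HOL-Combinatorics.Permutations"
begin

text \<open>The Lie algebra g is identified with real^'n via a basis e_i; g* is real^'n via the dual
coordinates xi_i = xi(e_i). The structure constants are c k i j = c^k_{ij}, i.e.
[e_i, e_j] = sum_k c^k_{ij} e_k.\<close>

definition lie_sc :: "('n::finite \<Rightarrow> 'n \<Rightarrow> 'n \<Rightarrow> real) \<Rightarrow> bool" where
  "lie_sc c \<longleftrightarrow> (\<forall>i j k. c k i j = - c k j i) \<and>
     (\<forall>i j k m. (\<Sum>l\<in>UNIV. c l i j * c m l k + c l j k * c m l i + c l k i * c m l j) = 0)"

definition pd :: "'n::finite \<Rightarrow> (real^'n \<Rightarrow> real) \<Rightarrow> real^'n \<Rightarrow> real" where
  "pd i f x = deriv (\<lambda>t. f (x + t *\<^sub>R axis i 1)) 0"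

fun dpd :: "'n::finite list \<Rightarrow> (real^'n \<Rightarrow> real) \<Rightarrow> real^'n \<Rightarrow> real" where
  "dpd [] f = f"
| "dpd (i # is) f = pd i (dpd is f)"

definition smooth :: "(real^'n::finite \<Rightarrow> real) \<Rightarrow> bool" where
  "smooth f \<longleftrightarrow> (\<forall>is. continuous_on UNIV (dpd is f) \<and>
      (\<forall>i x. (\<lambda>t. dpd is f (x + t *\<^sub>R axis i 1)) differentiable (at 0)))"

definition cinf_conv :: "(nat \<Rightarrow> real^'n::finite \<Rightarrow> real) \<Rightarrow> (real^'n \<Rightarrow> real) \<Rightarrow> bool" where
  "cinf_conv p f \<longleftrightarrow> (\<forall>is K. compact K \<longrightarrow>
      uniform_limit K (\<lambda>m. dpd is (p m)) (dpd is f) sequentially)"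

definition pb :: "('n::finite \<Rightarrow> 'n \<Rightarrow> 'n \<Rightarrow> real) \<Rightarrow> (real^'n \<Rightarrow> real) \<Rightarrow> (real^'n \<Rightarrow> real) \<Rightarrow> real^'n \<Rightarrow> real" where
  "pb c f g = (\<lambda>\<xi>. \<Sum>i\<in>UNIV. \<Sum>j\<in>UNIV. \<Sum>k\<in>UNIV. \<xi> $ k * c k i j * pd i f \<xi> * pd j g \<xi>)"

definition hat :: "real^'n::finite \<Rightarrow> real^'n \<Rightarrow> real" where
  "hat x = (\<lambda>\<xi>. x \<bullet> \<xi>)"

definition fin_supp :: "('n list \<Rightarrow> real) \<Rightarrow> bool" where
  "fin_supp P \<longleftrightarrow> finite {w. P w \<noteq> 0}"

definition peval :: "('n::finite list \<Rightarrow> real) \<Rightarrow> real^'n \<Rightarrow> real" where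
  "peval P = (\<lambda>\<xi>. \<Sum>w | P w \<noteq> 0. P w * prod_list (map (\<lambda>i. \<xi> $ i) w))"

definition polyfun :: "(real^'n::finite \<Rightarrow> real) \<Rightarrow> bool" where
  "polyfun p \<longleftrightarrow> (\<exists>P. fin_supp P \<and> p = peval P)"

definition wmult :: "('n list \<Rightarrow> real) \<Rightarrow> ('n list \<Rightarrow> real) \<Rightarrow> 'n list \<Rightarrow> real" where
  "wmult a b = (\<lambda>w. \<Sum>i\<le>length w. a (take i w) * b (drop i w))"

definition word :: "'n list \<Rightarrow> 'n list \<Rightarrow> real" where
  "word u = (\<lambda>w. if w = u then 1 else 0)"

definition lie_rel :: "('n::finite \<Rightarrow> 'n \<Rightarrow> 'n \<Rightarrow> real) \<Rightarrow> 'n \<Rightarrow> 'n \<Rightarrow> 'n list \<Rightarrow> real" where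
  "lie_rel c i j = (\<lambda>w. word [i, j] w - word [j, i] w - (\<Sum>k\<in>UNIV. c k i j * word [k] w))"

text \<open>The two-sided ideal generated by x(x)y - y(x)x - [x,y]; U(g) = free algebra / uideal c.\<close>
inductive_set uideal :: "('n::finite \<Rightarrow> 'n \<Rightarrow> 'n \<Rightarrow> real) \<Rightarrow> ('n list \<Rightarrow> real) set"
  for c where
  zero: "(\<lambda>_. 0) \<in> uideal c"
| step: "a \<in> uideal c \<Longrightarrow>
     (\<lambda>w. a w + r * wmult (wmult (word u) (lie_rel c i j)) (word v) w) \<in> uideal c"

definition sym_word :: "'n list \<Rightarrow> 'n list \<Rightarrow> real" where
  "sym_word w = (\<lambda>u. (\<Sum>\<tau> | \<tau> permutes {..<length w}.
       if map (\<lambda>j. w ! \<tau> j) [0..<length w] = u then 1 else 0) / fact (length w))"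

text \<open>A formal series F = sum_s nu^s F_s is a map nat => function; a star product is given by
  its bilinear operators C r, f * g = sum_r nu^r C r f g.\<close>

definition star :: "(nat \<Rightarrow> (real^'n \<Rightarrow> real) \<Rightarrow> (real^'n \<Rightarrow> real) \<Rightarrow> real^'n \<Rightarrow> real)
    \<Rightarrow> (nat \<Rightarrow> real^'n \<Rightarrow> real) \<Rightarrow> (nat \<Rightarrow> real^'n \<Rightarrow> real) \<Rightarrow> nat \<Rightarrow> real^'n \<Rightarrow> real" where
  "star C F G s = (\<lambda>x. \<Sum>a\<le>s. \<Sum>b\<le>s - a. C a (F b) (G (s - a - b)) x)"

definition comm :: "(nat \<Rightarrow> (real^'n \<Rightarrow> real) \<Rightarrow> (real^'n \<Rightarrow> real) \<Rightarrow> real^'n \<Rightarrow> real)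
    \<Rightarrow> (nat \<Rightarrow> real^'n \<Rightarrow> real) \<Rightarrow> (nat \<Rightarrow> real^'n \<Rightarrow> real) \<Rightarrow> nat \<Rightarrow> real^'n \<Rightarrow> real" where
  "comm C F G s = (\<lambda>x. star C F G s x - star C G F s x)"

definition cser :: "(real^'n \<Rightarrow> real) \<Rightarrow> nat \<Rightarrow> real^'n \<Rightarrow> real" where
  "cser f = (\<lambda>s. if s = 0 then f else (\<lambda>_. 0))"

definition bidiff :: "(nat \<Rightarrow> (real^'n::finite \<Rightarrow> real) \<Rightarrow> (real^'n \<Rightarrow> real) \<Rightarrow> real^'n \<Rightarrow> real) \<Rightarrow> bool" where
  "bidiff C \<longleftrightarrow> (\<forall>r. \<exists>N a. (\<forall>\<alpha> \<beta>. smooth (a \<alpha> \<beta>)) \<and>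
     (\<forall>f g. smooth f \<longrightarrow> smooth g \<longrightarrow>
        C r f g = (\<lambda>x. \<Sum>\<alpha>\<in>{w. length w \<le> N}. \<Sum>\<beta>\<in>{w. length w \<le> N}.
                        a \<alpha> \<beta> x * dpd \<alpha> f x * dpd \<beta> g x)))"

text \<open>sigma_nu(f * g) = sigma_nu(f) . sigma_nu(g) in U(g)[[nu]] for polynomials f, g:
  compared order by order in nu, modulo the ideal defining U(g).\<close>
definition bch_poly :: "('n::finite \<Rightarrow> 'n \<Rightarrow> 'n \<Rightarrow> real)
    \<Rightarrow> (nat \<Rightarrow> (real^'n \<Rightarrow> real) \<Rightarrow> (real^'n \<Rightarrow> real) \<Rightarrow> real^'n \<Rightarrow> real) \<Rightarrow> bool" where
  "bch_poly c C \<longleftrightarrow> (\<forall>P Q. fin_supp P \<longrightarrow> fin_supp Q \<longrightarrow>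
     (\<exists>R. (\<forall>r. fin_supp (R r) \<and> C r (peval P) (peval Q) = peval (R r)) \<and>
       (\<forall>N. (\<lambda>w. (\<Sum>r\<le>N. \<Sum>u | R r u \<noteq> 0 \<and> r + length u = N. R r u * sym_word u w)
              - (\<Sum>(u, v) | P u \<noteq> 0 \<and> Q v \<noteq> 0 \<and> length u + length v = N.
                   P u * Q v * wmult (sym_word u) (sym_word v) w)) \<in> uideal c)))"

text \<open>The BCH star product: differential, and matching the product of U(g) on polynomials
  (these conditions determine it uniquely).\<close>
definition bch_star :: "('n::finite \<Rightarrow> 'n \<Rightarrow> 'n \<Rightarrow> real)
    \<Rightarrow> (nat \<Rightarrow> (real^'n \<Rightarrow> real) \<Rightarrow> (real^'n \<Rightarrow> real) \<Rightarrow> real^'n \<Rightarrow> real) \<Rightarrow> bool" where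
  "bch_star c C \<longleftrightarrow> bidiff C \<and> bch_poly c C"

end

theory Submission
  imports Defs
begin

text \<open>The trace condition splits into one condition for every \<open>\<tau>\<^sub>r\<close> and every order of \<open>\<nu>\<close>. Since
  \<open>[x, g] = \<nu> {x, g}\<close> for linear \<open>x\<close>, an invariant functional kills all star commutators with linear
  functions; by \<open>[f \<star> h, g] = [f, h \<star> g] + [h, g \<star> f]\<close> it then kills those with all polynomials, hence by
  continuity and density of polynomials those with all smooth functions, and \<open>{f, g}\<close> is
  the first order term of \<open>[f, g]\<close>. The identities for the star product (associativity, unit, commutator
  with linear functions) are identities in the enveloping algebra: they hold for monomials because
  symmetrization is injective (Poincare-Birkhoff-Witt), and extend to smooth functions by density.\<close>

section \<open>A linear form on words respecting the relations of the enveloping algebra\<close>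

text \<open>The defining property of the product compares words only modulo \<open>uideal c\<close>,
  so no identity between polynomials follows from it until symmetrization is known to be injective;
  this is why Poincare-Birkhoff-Witt has to come before everything else. Giving nu degree one makes
  the product homogeneous: in total degree N the coefficient of nu^s is a polynomial of degree N -
  s. So nu can be set to one in the enveloping algebra, and a single element there still determines
  every order.

  The cyclic form of the Leibniz rule is chosen because both terms on its right are commutators with
  an element of the ideal. The usual form, f times [h, g] plus [f, g] times h, consists of products,
  about which invariance says nothing. Continuity is assumed only in f for a fixed g, so the
  induction on degree keeps g arbitrary in the ideal and density enters through f alone. From traces
  back to invariance, the orders separate because a commutator with a linear function lives in order
  one only.\<close>

fun descent :: "('n \<Rightarrow> nat) \<Rightarrow> 'n list \<Rightarrow> ('n list \<times> 'n \<times> 'n \<times> 'n list) option" where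
  "descent key (a # b # v) = (if key b < key a then Some ([], a, b, v)
     else map_option (\<lambda>(u, x, y, z). (a # u, x, y, z)) (descent key (b # v)))"
| "descent key _ = None"

lemma descent_SomeD:
  "descent key w = Some (u, a, b, v) \<Longrightarrow> w = u @ a # b # v \<and> key b < key a"
  by (induction key w arbitrary: u rule: descent.induct) (auto split: if_splits)

text \<open>The first descent never lies to the right of a given one, which leaves three relative
  positions to compare: equal, overlapping in one letter, disjoint.\<close>

lemma descent_first:
  assumes "w = u' @ a' # b' # v'" "key b' < key a'"
  obtains u a b v where "descent key w = Some (u, a, b, v)" "length u \<le> length u'"
proof -
  have "\<exists>u a b v. descent key w = Some (u, a, b, v) \<and> length u \<le> length u'"
    using assms
  proof (induction u' arbitrary: w)
    case (Cons x u')
    obtain y z where yz: "u' @ a' # b' # v' = y # z"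
      by (cases "u' @ a' # b' # v'") auto
    obtain u a b v where "descent key (y # z) = Some (u, a, b, v)" "length u \<le> length u'"
      using Cons.IH[OF refl Cons.prems(2)] yz by auto
    then show ?case using Cons.prems(1) yz by auto
  qed auto
  then show ?thesis using that by blast
qed

fun inversions :: "('n \<Rightarrow> nat) \<Rightarrow> 'n list \<Rightarrow> nat" where
  "inversions key [] = 0"
| "inversions key (a # w) = size (filter_mset (\<lambda>b. key b < key a) (mset w)) + inversions key w"

text \<open>Every pair of letters other than \<open>a\<close>, \<open>b\<close> keeps its relative
  order, so exactly one inversion disappears.\<close>

lemma inversions_swap:
  "key b < key a \<Longrightarrow> inversions key (u @ b # a # v) < inversions key (u @ a # b # v)"
  by (induction u) (auto simp: add_mset_commute)

text \<open>The coefficient of the sorted word with letters \<open>M\<close> in the expansion of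
  \<open>w\<close> into sorted words: first descents are straightened by ab = ba + [a,b] until none
  is left. For injective \<open>key\<close> a sorted word is determined by its multiset.\<close>

function normal_form :: "('n \<Rightarrow> nat) \<Rightarrow> ('n::finite \<Rightarrow> 'n \<Rightarrow> 'n \<Rightarrow> real) \<Rightarrow> 'n multiset \<Rightarrow> 'n list \<Rightarrow> real" where
  "normal_form key c M w = (case descent key w of None \<Rightarrow> of_bool (mset w = M)
     | Some (u, a, b, v) \<Rightarrow> normal_form key c M (u @ b # a # v)
         + (\<Sum>k\<in>UNIV. c k a b * normal_form key c M (u @ k # v)))"
  by auto
termination
  \<comment> \<open>Swapping keeps the length and removes an inversion; the bracket terms are
    shorter, though they may have more inversions.\<close>
  by (relation "inv_image (less_than <*lex*> less_than) (\<lambda>(key, c, M, w). (length w, inversions key w))")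
     (auto dest!: descent_SomeD intro: inversions_swap)

declare normal_form.simps[simp del]

lemma normal_form_descent:
  assumes "descent key w = Some (u, a, b, v)"
  shows "normal_form key c M w = normal_form key c M (u @ b # a # v)
         + (\<Sum>k\<in>UNIV. c k a b * normal_form key c M (u @ k # v))"
  by (subst normal_form.simps) (simp add: assms)

text \<open>The bracket terms produced on the way are shorter than the size of \<open>M\<close> and
  contribute nothing; only the swaps remain, and they preserve the multiset.\<close>

lemma normal_form_leading:
  "length w \<le> size M \<Longrightarrow> normal_form key c M w = of_bool (mset w = M)"
proof (induction key c M w rule: normal_form.induct)
  case (1 key c M w)
  show ?case
  proof (cases "descent key w")
    case None
    then show ?thesis by (simp add: normal_form.simps)
  next
    case (Some t)
    obtain u a b v where t: "t = (u, a, b, v)" by (cases t)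
    note w = descent_SomeD[OF Some[unfolded t]]
    have "normal_form key c M (u @ k # v) = 0" for k
    proof -
      have "mset (u @ k # v) \<noteq> M" using w "1.prems" by auto
      moreover have "normal_form key c M (u @ k # v) = of_bool (mset (u @ k # v) = M)"
        using w "1.prems" by (intro "1.IH"(2)[OF Some]) (auto simp: t)
      ultimately show ?thesis by simp
    qed
    moreover have "normal_form key c M (u @ b # a # v) = of_bool (mset (u @ b # a # v) = M)"
      using w "1.prems" by (intro "1.IH"(1)[OF Some]) (auto simp: t)
    ultimately show ?thesis
      unfolding normal_form_descent[OF Some[unfolded t]] using w by (simp add: add_mset_commute)
  qed
qed

lemma lie_sc_diag: "lie_sc c \<Longrightarrow> c k a a = 0"
  unfolding lie_sc_def by (metis neg_equal_zero)

lemma lie_sc_skew: "lie_sc c \<Longrightarrow> c k a b = - c k b a"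
  unfolding lie_sc_def by blast

text \<open>The Jacobi identity paired with a function of the resulting letter; for overlapping
  descents that function is the normal form of a word with one free letter.\<close>

lemma sum_jacobi:
  fixes c :: "'n::finite \<Rightarrow> 'n \<Rightarrow> 'n \<Rightarrow> real"
  assumes "lie_sc c"
  shows "(\<Sum>k\<in>UNIV. c k a b * (\<Sum>m\<in>UNIV. c m k d * f m)) + (\<Sum>k\<in>UNIV. c k b d * (\<Sum>m\<in>UNIV. c m k a * f m))
       + (\<Sum>k\<in>UNIV. c k d a * (\<Sum>m\<in>UNIV. c m k b * f m)) = 0"
proof -
  have "(\<Sum>k\<in>UNIV. c k a b * (\<Sum>m\<in>UNIV. c m k d * f m)) + (\<Sum>k\<in>UNIV. c k b d * (\<Sum>m\<in>UNIV. c m k a * f m))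
       + (\<Sum>k\<in>UNIV. c k d a * (\<Sum>m\<in>UNIV. c m k b * f m))
     = (\<Sum>k\<in>UNIV. \<Sum>m\<in>UNIV. (c k a b * c m k d + c k b d * c m k a + c k d a * c m k b) * f m)"
    by (simp only: sum_distrib_left sum.distrib distrib_right mult.assoc)
  also have "\<dots> = (\<Sum>m\<in>UNIV. (\<Sum>k\<in>UNIV. c k a b * c m k d + c k b d * c m k a + c k d a * c m k b) * f m)"
    by (subst sum.swap) (simp only: sum_distrib_right)
  also have "\<dots> = 0"
    using assms unfolding lie_sc_def by (intro sum.neutral ballI) (metis mult_zero_left)
  finally show ?thesis .
qed

text \<open>The normal form rewrites at the first descent; that it respects the relation at every other
  position is the diamond lemma, where two overlapping descents are reconciled by the Jacobi identity.\<close>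

lemma normal_form_relation:
  fixes c :: "'n::finite \<Rightarrow> 'n \<Rightarrow> 'n \<Rightarrow> real"
  assumes lie: "lie_sc c" and inj: "inj key"
  shows "normal_form key c M (u @ a # b # v) = normal_form key c M (u @ b # a # v)
         + (\<Sum>k\<in>UNIV. c k a b * normal_form key c M (u @ k # v))"
proof -
  let ?L = "normal_form key c M"
  define rel where "rel u a b v \<longleftrightarrow>
    ?L (u @ a # b # v) = ?L (u @ b # a # v) + (\<Sum>k\<in>UNIV. c k a b * ?L (u @ k # v))" for u a b v
  \<comment> \<open>By skew symmetry both orders of a pair give the same relation, and for equal
    letters it is trivial, so only descents need an argument.\<close>
  have symm: "rel u a b v" if d: "key b < key a \<Longrightarrow> rel u a b v" "key a < key b \<Longrightarrow> rel u b a v" for u a b v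
  proof -
    consider "key b < key a" | "key a < key b" | "a = b"
      using inj by (metis linorder_neqE_nat injD)
    then show ?thesis
    proof cases
      case 2
      have "(\<Sum>k\<in>UNIV. c k a b * ?L (u @ k # v)) = - (\<Sum>k\<in>UNIV. c k b a * ?L (u @ k # v))"
        by (subst lie_sc_skew[OF lie]) (simp add: sum_negf)
      with d(2)[OF 2] show ?thesis unfolding rel_def by simp
    next
      case 3
      then show ?thesis unfolding rel_def by (simp add: lie_sc_diag[OF lie])
    qed (use d in auto)
  qed
  have main: "rel u a b v" if "key b < key a" "w = u @ a # b # v" for w u a b v
    using that
  proof (induction w arbitrary: u a b v
      rule: wf_induct_rule[OF wf_inv_image[OF wf_lex_prod[OF wf_less_than wf_less_than],
        of "\<lambda>w. (length w, inversions key w)"]])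
    case (1 w)
    \<comment> \<open>The induction hypothesis in two forms: for shorter words with the letters in
      any order, for words of equal length at a descent with fewer inversions.\<close>
    have shorter: "rel u' a' b' v'" if "length (u' @ a' # b' # v') < length w" for u' a' b' v'
      by (rule symm) (rule "1.IH"[OF _ _ refl]; use that in auto)+
    have swapped: "rel u' a' b' v'"
      if "key b' < key a'" "length (u' @ a' # b' # v') = length w"
         "inversions key (u' @ a' # b' # v') < inversions key w" for u' a' b' v'
      by (rule "1.IH"[OF _ _ refl]) (use that in auto)
    obtain u0 a0 b0 v0 where d: "descent key w = Some (u0, a0, b0, v0)" and le: "length u0 \<le> length u"
      using descent_first "1.prems" by metis
    note w0 = descent_SomeD[OF d] and L0 = normal_form_descent[OF d, of c M]
    obtain us where us: "u = u0 @ us" "us @ a # b # v = a0 # b0 # v0"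
      using w0 "1.prems"(2) le by (auto simp: append_eq_append_conv2)
    have "us = [] \<or> us = [a0] \<or> (\<exists>m. us = a0 # b0 # m)"
      using us(2) by (cases us; cases "tl us") auto
    then consider "us = []" | "us = [a0]" | m where "us = a0 # b0 # m" by blast
    then show ?case
    proof cases
      case 1
      then show ?thesis using us L0 w0 unfolding rel_def by auto
    next
      case 2
      then have eq: "u = u0 @ [a0]" "a = b0" "v0 = b # v" using us by auto
      \<comment> \<open>Three decreasing letters a0 b0 b. The routes through b0 a0 b and through a0
        b b0 both end in b b0 a0, and all words after the first swap precede \<open>w\<close>, so
        the relation is available for each of them.\<close>
      have ord: "key b < key b0" "key b0 < key a0" using "1.prems" w0 eq by auto
      have "inversions key (u0 @ b0 # a0 # b # v) < inversions key w"
        using w0 eq inversions_swap[of key b0 a0 u0 "b # v"] by simp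
      moreover have "inversions key (u0 @ b0 # b # a0 # v) < inversions key (u0 @ b0 # a0 # b # v)"
        using ord inversions_swap[of key b a0 "u0 @ [b0]" v] by simp
      moreover have "inversions key (u0 @ a0 # b # b0 # v) < inversions key w"
        using ord w0 eq inversions_swap[of key b b0 "u0 @ [a0]" v] by simp
      moreover have "inversions key (u0 @ b # a0 # b0 # v) < inversions key (u0 @ a0 # b # b0 # v)"
        using ord inversions_swap[of key b a0 u0 "b0 # v"] by simp
      ultimately have S: "rel (u0 @ [b0]) a0 b v" "rel u0 b0 b (a0 # v)"
          "rel u0 a0 b (b0 # v)" "rel (u0 @ [b]) a0 b0 v"
        using ord w0 eq by (auto intro!: swapped)
      have "rel u0 k x v" for k x using w0 eq by (auto intro!: shorter)
      \<comment> \<open>The bracket terms of the two routes contain the same two letters in opposite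
        orders; exchanging them leaves double brackets, whose sum is zero by Jacobi.\<close>
      then have R: "?L (u0 @ k # x # v) = ?L (u0 @ x # k # v) + (\<Sum>m\<in>UNIV. c m k x * ?L (u0 @ m # v))" for k x
        unfolding rel_def append_assoc append_Cons append_Nil .
      note S' = S[unfolded rel_def append_assoc append_Cons append_Nil]
      have "(\<Sum>k\<in>UNIV. c k a0 b0 * ?L (u0 @ k # b # v)) = (\<Sum>k\<in>UNIV. c k a0 b0 * ?L (u0 @ b # k # v))
          + (\<Sum>k\<in>UNIV. c k a0 b0 * (\<Sum>m\<in>UNIV. c m k b * ?L (u0 @ m # v)))"
        by (subst R) (simp only: distrib_left sum.distrib)
      moreover have "(\<Sum>k\<in>UNIV. c k b0 b * ?L (u0 @ k # a0 # v)) = (\<Sum>k\<in>UNIV. c k b0 b * ?L (u0 @ a0 # k # v))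
          + (\<Sum>k\<in>UNIV. c k b0 b * (\<Sum>m\<in>UNIV. c m k a0 * ?L (u0 @ m # v)))"
        by (subst R) (simp only: distrib_left sum.distrib)
      moreover have "(\<Sum>k\<in>UNIV. c k a0 b * ?L (u0 @ k # b0 # v)) = (\<Sum>k\<in>UNIV. c k a0 b * ?L (u0 @ b0 # k # v))
          + (\<Sum>k\<in>UNIV. c k a0 b * (\<Sum>m\<in>UNIV. c m k b0 * ?L (u0 @ m # v)))"
        by (subst R) (simp only: distrib_left sum.distrib)
      moreover have "(\<Sum>k\<in>UNIV. c k a0 b * (\<Sum>m\<in>UNIV. c m k b0 * ?L (u0 @ m # v)))
          = - (\<Sum>k\<in>UNIV. c k b a0 * (\<Sum>m\<in>UNIV. c m k b0 * ?L (u0 @ m # v)))"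
        by (simp only: lie_sc_skew[OF lie, of _ a0 b] sum_negf[symmetric] mult_minus_left)
      moreover note sum_jacobi[OF lie, of a0 b0 b "\<lambda>m. ?L (u0 @ m # v)"]
      moreover have "?L (u0 @ a0 # b0 # b # v) = ?L (u0 @ b0 # a0 # b # v) + (\<Sum>k\<in>UNIV. c k a0 b0 * ?L (u0 @ k # b # v))"
        using L0 w0 eq by simp
      ultimately show ?thesis
        unfolding rel_def eq append_assoc append_Cons append_Nil using S' by linarith
    next
      case 3
      then have eq: "u = u0 @ a0 # b0 # m" "v0 = m @ a # b # v" using us by auto
      have ord: "key b < key a" "key b0 < key a0" using "1.prems" w0 by auto
      have "inversions key (u0 @ b0 # a0 # m @ a # b # v) < inversions key w"
        using w0 eq inversions_swap[of key b0 a0 u0 "m @ a # b # v"] by simp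
      moreover have "inversions key (u0 @ a0 # b0 # m @ b # a # v) < inversions key w"
        using ord w0 eq inversions_swap[of key b a "u0 @ a0 # b0 # m" v] by simp
      ultimately have S: "rel (u0 @ b0 # a0 # m) a b v" "rel u0 a0 b0 (m @ b # a # v)"
        using ord w0 eq by (auto intro!: swapped)
      have A: "rel (u0 @ k # m) a b v" for k using w0 eq by (auto intro!: shorter)
      have B: "rel u0 a0 b0 (m @ k # v)" for k using w0 eq by (auto intro!: shorter)
      \<comment> \<open>Disjoint descents: straightening them in either order produces the same
        double sum, which cancels.\<close>
      have "(\<Sum>k\<in>UNIV. c k a0 b0 * ?L (u0 @ k # m @ a # b # v))
          = (\<Sum>k\<in>UNIV. c k a0 b0 * ?L (u0 @ k # m @ b # a # v))
          + (\<Sum>k\<in>UNIV. \<Sum>l\<in>UNIV. c k a0 b0 * c l a b * ?L (u0 @ k # m @ l # v))"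
        using A unfolding rel_def by (simp add: algebra_simps sum.distrib sum_distrib_left)
      moreover have "(\<Sum>l\<in>UNIV. c l a b * ?L (u0 @ a0 # b0 # m @ l # v))
          = (\<Sum>l\<in>UNIV. c l a b * ?L (u0 @ b0 # a0 # m @ l # v))
          + (\<Sum>k\<in>UNIV. \<Sum>l\<in>UNIV. c k a0 b0 * c l a b * ?L (u0 @ k # m @ l # v))"
        using B unfolding rel_def
        by (subst sum.swap) (simp add: algebra_simps sum.distrib sum_distrib_left)
      moreover have "?L (u0 @ a0 # b0 # m @ a # b # v) = ?L (u0 @ b0 # a0 # m @ a # b # v)
          + (\<Sum>k\<in>UNIV. c k a0 b0 * ?L (u0 @ k # m @ a # b # v))"
        using L0 w0 eq by simp
      ultimately show ?thesis
        using S unfolding rel_def eq append_assoc append_Cons append_Nil by linarith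
    qed
  qed
  have "rel u a b v" by (rule symm) (rule main[OF _ refl]; assumption)+
  then show ?thesis by (simp add: rel_def)
qed

text \<open>The dual form: instead of a basis of the enveloping algebra, for each \<open>M\<close> a
  linear form that descends to the quotient and reads the commutative coefficient of
  \<open>M\<close> in all degrees up to the size of \<open>M\<close>. A top degree argument needs
  just this.\<close>

theorem poincare_birkhoff_witt:
  fixes c :: "'n::finite \<Rightarrow> 'n \<Rightarrow> 'n \<Rightarrow> real"
  assumes "lie_sc c"
  obtains L :: "'n list \<Rightarrow> real" where
    "\<And>u a b v. L (u @ [a, b] @ v) = L (u @ [b, a] @ v) + (\<Sum>k\<in>UNIV. c k a b * L (u @ [k] @ v))"
    "\<And>w. length w \<le> size M \<Longrightarrow> L w = of_bool (mset w = M)"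
proof -
  obtain key :: "'n \<Rightarrow> nat" where "inj key"
    using finite_imp_inj_to_nat_seg[of "UNIV :: 'n set"] by auto
  then show ?thesis
    by (intro that[of "normal_form key c M"])
       (simp_all add: normal_form_leading, rule normal_form_relation[OF assms])
qed

section \<open>Symmetrization into the enveloping algebra\<close>

text \<open>Linear extension from words to the free algebra. Over an infinite support the sum has
  the default value 0, hence the finiteness hypotheses in the additivity lemmas.\<close>

definition lin :: "('n list \<Rightarrow> real) \<Rightarrow> ('n list \<Rightarrow> real) \<Rightarrow> real" where
  "lin \<phi> a = (\<Sum>w | a w \<noteq> 0. a w * \<phi> w)"

definition mon :: "'n::finite list \<Rightarrow> real^'n \<Rightarrow> real" where
  "mon w \<xi> = prod_list (map (\<lambda>i. \<xi> $ i) w)"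

lemma mon_simps [simp]: "mon [] = (\<lambda>_. 1)" "mon (i # w) = (\<lambda>\<xi>. \<xi> $ i * mon w \<xi>)"
  by (auto simp: mon_def)

lemma mon_append: "mon (u @ v) \<xi> = mon u \<xi> * mon v \<xi>"
  by (simp add: mon_def)

lemma mon_mset: "mon w \<xi> = prod_mset (image_mset (\<lambda>i. \<xi> $ i) (mset w))"
  by (induction w) auto

lemma peval_eq_lin: "peval P \<xi> = lin (\<lambda>w. mon w \<xi>) P"
  by (simp add: peval_def lin_def mon_def)

lemma lin_superset:
  "finite S \<Longrightarrow> {w. a w \<noteq> 0} \<subseteq> S \<Longrightarrow> lin \<phi> a = (\<Sum>w\<in>S. a w * \<phi> w)"
  unfolding lin_def by (rule sum.mono_neutral_left) auto

lemma fin_supp_word [simp]: "fin_supp (word u)"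
  unfolding fin_supp_def word_def by (rule finite_subset[of _ "{u}"]) auto

lemma fin_supp_zero [simp]: "fin_supp (\<lambda>_. 0)"
  by (simp add: fin_supp_def)

lemma fin_supp_scale [simp]: "fin_supp a \<Longrightarrow> fin_supp (\<lambda>w. r * a w)"
  unfolding fin_supp_def by (rule finite_subset[rotated]) auto

lemma fin_supp_add [simp]: "fin_supp a \<Longrightarrow> fin_supp b \<Longrightarrow> fin_supp (\<lambda>w. a w + b w)"
  unfolding fin_supp_def by (rule finite_subset[of _ "{w. a w \<noteq> 0} \<union> {w. b w \<noteq> 0}"]) auto

lemma fin_supp_diff [simp]: "fin_supp a \<Longrightarrow> fin_supp b \<Longrightarrow> fin_supp (\<lambda>w. a w - b w)"
  unfolding fin_supp_def by (rule finite_subset[of _ "{w. a w \<noteq> 0} \<union> {w. b w \<noteq> 0}"]) auto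

lemma fin_supp_sum [simp]: "(\<And>i. i \<in> I \<Longrightarrow> fin_supp (a i)) \<Longrightarrow> fin_supp (\<lambda>w. \<Sum>i\<in>I. a i w)"
  by (induction I rule: infinite_finite_induct) auto

lemma lin_zero [simp]: "lin \<phi> (\<lambda>_. 0) = 0"
  by (simp add: lin_def)

lemma lin_word [simp]: "lin \<phi> (word u) = \<phi> u"
  by (subst lin_superset[of "{u}"]) (auto simp: word_def)

lemma lin_scale [simp]: "lin \<phi> (\<lambda>w. r * a w) = r * lin \<phi> a"
  by (cases "r = 0") (auto simp: lin_def sum_distrib_left mult.assoc)

lemma lin_add [simp]:
  assumes "fin_supp a" "fin_supp b"
  shows "lin \<phi> (\<lambda>w. a w + b w) = lin \<phi> a + lin \<phi> b"
proof -
  let ?S = "{w. a w \<noteq> 0} \<union> {w. b w \<noteq> 0}"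
  have "finite ?S" using assms by (simp add: fin_supp_def)
  then have "lin \<phi> a = (\<Sum>w\<in>?S. a w * \<phi> w)" "lin \<phi> b = (\<Sum>w\<in>?S. b w * \<phi> w)"
    "lin \<phi> (\<lambda>w. a w + b w) = (\<Sum>w\<in>?S. (a w + b w) * \<phi> w)"
    by (intro lin_superset; auto)+
  then show ?thesis by (simp add: sum.distrib distrib_right)
qed

lemma lin_diff [simp]:
  assumes "fin_supp a" "fin_supp b"
  shows "lin \<phi> (\<lambda>w. a w - b w) = lin \<phi> a - lin \<phi> b"
  using lin_add[OF assms(1) fin_supp_scale[OF assms(2)], of \<phi> "-1"] by (simp only: lin_scale) simp

lemma lin_sum [simp]:
  "(\<And>i. i \<in> I \<Longrightarrow> fin_supp (a i)) \<Longrightarrow> lin \<phi> (\<lambda>w. \<Sum>i\<in>I. a i w) = (\<Sum>i\<in>I. lin \<phi> (a i))"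
  by (induction I rule: infinite_finite_induct) auto

lemma fin_supp_expand: "fin_supp a \<Longrightarrow> a = (\<lambda>w. \<Sum>u | a u \<noteq> 0. a u * word u w)"
  unfolding fin_supp_def word_def by (auto simp: if_distrib cong: if_cong)

lemma fin_supp_induct [consumes 1, case_names zero add]:
  assumes "fin_supp a" and zero: "P (\<lambda>_. 0)"
    and add: "\<And>a r u. fin_supp a \<Longrightarrow> P a \<Longrightarrow> P (\<lambda>w. a w + r * word u w)"
  shows "P a"
proof -
  have "P (\<lambda>w. \<Sum>u\<in>S. f u * word u w)" if "finite S" for S f
    using that
  proof (induction S)
    case (insert x S)
    then show ?case using add[of "\<lambda>w. \<Sum>u\<in>S. f u * word u w" "f x" x] by (simp add: add.commute)
  qed (simp add: zero)
  then show ?thesis using fin_supp_expand[OF assms(1)] assms(1) by (metis fin_supp_def)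
qed

lemma lin_homogeneous_cong:
  "(\<And>w. a w \<noteq> 0 \<Longrightarrow> \<phi> w = \<psi> w) \<Longrightarrow> lin \<phi> a = lin \<psi> a"
  unfolding lin_def by (rule sum.cong) auto

section \<open>The concatenation product of the free algebra\<close>

lemma wmult_word_word [simp]: "wmult (word u) (word v) = word (u @ v)"
proof
  fix w
  have "wmult (word u) (word v) w = (\<Sum>i\<le>length w. if i = length u \<and> w = u @ v then 1 else 0)"
    unfolding wmult_def word_def
  proof (rule sum.cong[OF refl])
    fix i assume "i \<in> {..length w}"
    then have "take i w = u \<and> drop i w = v \<longleftrightarrow> i = length u \<and> w = u @ v"
      using append_take_drop_id[of i w] by auto
    then show "(if take i w = u then 1 else 0) * (if drop i w = v then 1 else 0)
        = (if i = length u \<and> w = u @ v then 1 else (0 :: real))"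
      by auto
  qed
  also have "\<dots> = word (u @ v) w" by (auto simp: word_def)
  finally show "wmult (word u) (word v) w = word (u @ v) w" .
qed

lemma wmult_linear:
  "wmult (\<lambda>_. 0) b = (\<lambda>_. 0)" "wmult b (\<lambda>_. 0) = (\<lambda>_. 0)"
  "wmult (\<lambda>w. a w + a' w) b = (\<lambda>w. wmult a b w + wmult a' b w)"
  "wmult b (\<lambda>w. a w + a' w) = (\<lambda>w. wmult b a w + wmult b a' w)"
  "wmult (\<lambda>w. a w - a' w) b = (\<lambda>w. wmult a b w - wmult a' b w)"
  "wmult b (\<lambda>w. a w - a' w) = (\<lambda>w. wmult b a w - wmult b a' w)"
  "wmult (\<lambda>w. r * a w) b = (\<lambda>w. r * wmult a b w)"
  "wmult b (\<lambda>w. r * a w) = (\<lambda>w. r * wmult b a w)"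
  by (auto simp: wmult_def algebra_simps sum.distrib sum_subtractf sum_distrib_left)

lemma wmult_sum:
  "wmult (\<lambda>w. \<Sum>i\<in>I. a i w) b = (\<lambda>w. \<Sum>i\<in>I. wmult (a i) b w)"
  "wmult b (\<lambda>w. \<Sum>i\<in>I. a i w) = (\<lambda>w. \<Sum>i\<in>I. wmult b (a i) w)"
  unfolding wmult_def sum_distrib_left sum_distrib_right by (auto intro!: sum.swap)

lemma fin_supp_wmult [simp]: "fin_supp a \<Longrightarrow> fin_supp b \<Longrightarrow> fin_supp (wmult a b)"
proof (induction a rule: fin_supp_induct)
  case (add a r u)
  have "fin_supp (wmult (word u) b)"
    using add.prems by (induction b rule: fin_supp_induct) (simp_all add: wmult_linear)
  then show ?case using add by (simp add: wmult_linear)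
qed (simp add: wmult_linear)

lemma wmult_assoc:
  assumes "fin_supp a" "fin_supp b" "fin_supp d"
  shows "wmult (wmult a b) d = wmult a (wmult b d)"
proof -
  have 1: "wmult (wmult (word u) (word v)) d = wmult (word u) (wmult (word v) d)" for u v
    using assms(3) by (induction d rule: fin_supp_induct) (simp_all add: wmult_linear del: wmult_word_word, simp)
  have 2: "wmult (wmult (word u) b) d = wmult (word u) (wmult b d)" for u
    using assms(2) by (induction b rule: fin_supp_induct) (simp_all only: wmult_linear 1)
  show ?thesis
    using assms(1) by (induction a rule: fin_supp_induct) (simp_all only: wmult_linear 2)
qed

lemma wmult_unit: "fin_supp a \<Longrightarrow> wmult (word []) a = a" "fin_supp a \<Longrightarrow> wmult a (word []) = a"
  by (induction a rule: fin_supp_induct; simp add: wmult_linear)+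

lemma peval_wmult: 
  assumes "fin_supp a" "fin_supp b"
  shows "peval (wmult a b) \<xi> = peval a \<xi> * peval b \<xi>"
proof -
  have 1: "peval (wmult (word u) b) \<xi> = mon u \<xi> * peval b \<xi>" for u
    using assms(2)
    by (induction b rule: fin_supp_induct) (simp_all add: wmult_linear peval_eq_lin mon_append algebra_simps)
  show ?thesis
    using assms
  proof (induction a rule: fin_supp_induct)
    case (add a r u)
    then show ?case using 1[of u] by (simp add: wmult_linear peval_eq_lin distrib_right)
  qed (simp add: wmult_linear peval_eq_lin)
qed

section \<open>The ideal defining the enveloping algebra\<close>

lemma relator_words:
  "wmult (wmult (word u) (lie_rel c i j)) (word v) = (\<lambda>w. word (u @ [i, j] @ v) w
     - word (u @ [j, i] @ v) w - (\<Sum>k\<in>UNIV. c k i j * word (u @ [k] @ v) w))"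
proof -
  have "lie_rel c i j = (\<lambda>w. word [i, j] w - word [j, i] w - (\<Sum>k\<in>UNIV. c k i j * word [k] w))"
    by (simp add: lie_rel_def fun_eq_iff)
  then show ?thesis by (simp add: wmult_linear wmult_sum)
qed

text \<open>\<open>uideal\<close> grows by one multiple of a relator at a time, so the induction
  peels these off one summand and adds them to the other.\<close>

lemma uideal_add: "b \<in> uideal c \<Longrightarrow> a \<in> uideal c \<Longrightarrow> (\<lambda>w. a w + b w) \<in> uideal c"
proof (induction rule: uideal.induct)
  case (step b r u i j v)
  show ?case
    using uideal.step[OF step.IH[OF step.prems], of r u i j v] by (simp add: add.assoc)
qed simp

lemma uideal_scale: "b \<in> uideal c \<Longrightarrow> (\<lambda>w. s * b w) \<in> uideal c"
proof (induction rule: uideal.induct)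
  case (step b r u i j v)
  show ?case
    using uideal.step[OF step.IH, of "s * r" u i j v] by (simp add: algebra_simps)
qed (simp add: uideal.zero)

lemma uideal_sum: "(\<And>i. i \<in> I \<Longrightarrow> a i \<in> uideal c) \<Longrightarrow> (\<lambda>w. \<Sum>i\<in>I. a i w) \<in> uideal c"
  by (induction I rule: infinite_finite_induct) (auto intro: uideal.zero uideal_add)

lemma uideal_relator:
  "(\<lambda>w. word (u @ [i, j] @ v) w - word (u @ [j, i] @ v) w
     - (\<Sum>k\<in>UNIV. c k i j * word (u @ [k] @ v) w)) \<in> uideal c"
  using uideal.step[OF uideal.zero, where r = 1 and u = u and i = i and j = j and v = v] by (simp add: relator_words)

text \<open>A word on the left is absorbed into the left factor of each generator, and
  \<open>b\<close> is a combination of words.\<close>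

lemma uideal_wmult_left:
  assumes "a \<in> uideal c" "fin_supp b"
  shows "wmult b a \<in> uideal c"
proof -
  have word: "wmult (word x) a \<in> uideal c" for x
    using assms(1)
  proof (induction rule: uideal.induct)
    case (step a r u i j v)
    have "wmult (word x) (wmult (wmult (word u) (lie_rel c i j)) (word v))
        = wmult (wmult (word (x @ u)) (lie_rel c i j)) (word v)"
      unfolding relator_words by (simp add: wmult_linear wmult_sum)
    then show ?case
      using uideal.step[OF step.IH, of r "x @ u" i j v] by (simp add: wmult_linear)
  qed (simp add: wmult_linear uideal.zero)
  show ?thesis using assms(2)
    by (induction b rule: fin_supp_induct)
       (auto simp: wmult_linear uideal.zero intro!: uideal_add uideal_scale word)
qed

lemma uideal_wmult_right:
  assumes "a \<in> uideal c" "fin_supp b"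
  shows "wmult a b \<in> uideal c"
proof -
  have word: "wmult a (word x) \<in> uideal c" for x
    using assms(1)
  proof (induction rule: uideal.induct)
    case (step a r u i j v)
    have "wmult (wmult (wmult (word u) (lie_rel c i j)) (word v)) (word x)
        = wmult (wmult (word u) (lie_rel c i j)) (word (v @ x))"
      unfolding relator_words by (simp add: wmult_linear wmult_sum)
    then show ?case
      using uideal.step[OF step.IH, of r u i j "v @ x"] by (simp add: wmult_linear)
  qed (simp add: wmult_linear uideal.zero)
  show ?thesis using assms(2)
    by (induction b rule: fin_supp_induct)
       (auto simp: wmult_linear uideal.zero intro!: uideal_add uideal_scale word)
qed

lemma uideal_lin:
  assumes rel: "\<And>u a b v. L (u @ [a, b] @ v) = L (u @ [b, a] @ v) + (\<Sum>k\<in>UNIV. c k a b * L (u @ [k] @ v))"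
    and "a \<in> uideal c"
  shows "lin L a = 0"
proof -
  \<comment> \<open>Finite support is carried along because additivity of \<open>lin\<close>
    requires it.\<close>
  have "fin_supp a \<and> lin L a = 0" using assms(2)
  proof (induction rule: uideal.induct)
    case (step a r u i j v)
    then show ?case using rel[of u i j v] by (simp add: relator_words)
  qed simp
  then show ?thesis ..
qed

section \<open>Averaging a word over its permutations\<close>

definition perms :: "'n list \<Rightarrow> (nat \<Rightarrow> nat) set" where
  "perms w = {\<tau>. \<tau> permutes {..<length w}}"

lemma finite_perms [simp]: "finite (perms w)"
  by (simp add: perms_def finite_permutations)

lemma card_perms: "card (perms w) = fact (length w)"
  by (simp add: perms_def card_permutations)

lemma sym_word_eq: "sym_word w = (\<lambda>u. (\<Sum>\<tau>\<in>perms w. 1 / fact (length w) * word (permute_list \<tau> w) u))"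
  unfolding sym_word_def perms_def permute_list_def word_def
  unfolding sum_divide_distrib by (intro ext sum.cong refl) auto

lemma fin_supp_sym_word [simp]: "fin_supp (sym_word w)"
  unfolding sym_word_eq by (intro fin_supp_sum fin_supp_scale fin_supp_word)

lemma lin_sym_word:
  "lin \<phi> (sym_word w) = (\<Sum>\<tau>\<in>perms w. \<phi> (permute_list \<tau> w)) / fact (length w)"
  unfolding sym_word_eq
  by (simp only: lin_sum fin_supp_scale fin_supp_word lin_scale lin_word sum_divide_distrib) simp

lemma lin_sym_word_mset:
  assumes "\<And>u. mset u = mset w \<Longrightarrow> \<phi> u = x"
  shows "lin \<phi> (sym_word w) = x"
proof -
  have "(\<Sum>\<tau>\<in>perms w. \<phi> (permute_list \<tau> w)) = (\<Sum>\<tau>\<in>perms w. x)"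
    by (rule sum.cong) (auto simp: perms_def assms)
  then show ?thesis by (simp add: lin_sym_word card_perms)
qed

text \<open>A permutation \<open>p\<close> that rearranges \<open>v\<close> into \<open>u\<close>
  reindexes the average by left composition.\<close>

lemma sym_word_mset:
  assumes "mset u = mset v"
  shows "sym_word u = sym_word v"
proof -
  obtain p where p: "p permutes {..<length v}" "permute_list p v = u"
    using mset_eq_permutation[OF assms] .
  have len: "length u = length v" using assms by (rule mset_eq_length)
  have "(\<Sum>\<tau>\<in>perms u. 1 / fact (length u) * word (permute_list \<tau> u) w)
      = (\<Sum>\<tau>\<in>perms v. 1 / fact (length v) * word (permute_list \<tau> v) w)" for w
    unfolding perms_def len
  proof (rule sum.reindex_bij_witness[where i="\<lambda>\<tau>. inv p \<circ> \<tau>" and j="\<lambda>\<tau>. p \<circ> \<tau>"])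
    fix \<tau> assume \<tau>: "\<tau> \<in> {\<tau>. \<tau> permutes {..<length v}}"
    show "inv p \<circ> (p \<circ> \<tau>) = \<tau>" "p \<circ> (inv p \<circ> \<tau>) = \<tau>"
      by (simp_all add: o_assoc permutes_inv_o[OF p(1)])
    show "p \<circ> \<tau> \<in> {\<tau>. \<tau> permutes {..<length v}}" "inv p \<circ> \<tau> \<in> {\<tau>. \<tau> permutes {..<length v}}"
      using \<tau> p by (auto intro: permutes_compose permutes_inv)
    show "1 / fact (length v) * word (permute_list (p \<circ> \<tau>) v) w
        = 1 / fact (length v) * word (permute_list \<tau> u) w"
      using \<tau> p by (subst permute_list_compose) (auto simp: len)
  qed
  then show ?thesis by (simp add: sym_word_eq)
qed

lemma peval_sym_word: "peval (sym_word w) = mon w"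
  by (intro ext) (simp add: peval_eq_lin lin_sym_word_mset mon_mset)

lemma sym_word_support: "sym_word w u \<noteq> 0 \<Longrightarrow> mset u = mset w"
proof (rule ccontr)
  assume "sym_word w u \<noteq> 0" "mset u \<noteq> mset w"
  then have "word (permute_list \<tau> w) u = 0" if "\<tau> \<in> perms w" for \<tau>
    using that by (auto simp: word_def perms_def)
  with \<open>sym_word w u \<noteq> 0\<close> show False by (simp add: sym_word_eq)
qed

text \<open>The symmetrization, lifted to the free algebra. The powers of nu in sigma_nu are
  recorded by degrees instead.\<close>

definition sg :: "('n list \<Rightarrow> real) \<Rightarrow> 'n list \<Rightarrow> real" where
  "sg R = (\<lambda>w. lin (\<lambda>u. sym_word u w) R)"

lemma fin_supp_sg [simp]: "fin_supp (sg R)"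
  by (simp add: sg_def lin_def)

lemma lin_sg: "lin \<phi> (sg R) = lin (\<lambda>u. lin \<phi> (sym_word u)) R"
  by (simp add: sg_def lin_def[of _ R])

text \<open>Polynomials are represented by words, where \<open>[i, j]\<close> and
  \<open>[j, i]\<close> stand for the same monomial; this is the coefficient after collecting such
  words.\<close>

definition mset_coeff :: "'n multiset \<Rightarrow> ('n list \<Rightarrow> real) \<Rightarrow> real" where
  "mset_coeff M R = lin (\<lambda>u. of_bool (mset u = M)) R"

lemma lin_mset:
  assumes "fin_supp R" "\<And>u. R u \<noteq> 0 \<Longrightarrow> \<phi> u = \<psi> (mset u)"
  shows "lin \<phi> R = (\<Sum>M\<in>mset ` {u. R u \<noteq> 0}. mset_coeff M R * \<psi> M)"
proof -
  have "lin \<phi> R = (\<Sum>M\<in>mset ` {u. R u \<noteq> 0}. \<Sum>u\<in>{u\<in>{u. R u \<noteq> 0}. mset u = M}. R u * \<phi> u)"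
    unfolding lin_def by (rule sum.image_gen) (use assms in \<open>simp add: fin_supp_def\<close>)
  also have "\<dots> = (\<Sum>M\<in>mset ` {u. R u \<noteq> 0}. mset_coeff M R * \<psi> M)"
  proof (rule sum.cong[OF refl])
    fix M
    have "mset_coeff M R = (\<Sum>u\<in>{u\<in>{u. R u \<noteq> 0}. mset u = M}. R u)"
    proof -
      have "mset_coeff M R = (\<Sum>u\<in>{u. R u \<noteq> 0}. if mset u = M then R u else 0)"
        unfolding mset_coeff_def lin_def by (rule sum.cong) auto
      also have "\<dots> = (\<Sum>u\<in>{u\<in>{u. R u \<noteq> 0}. mset u = M}. R u)"
        using assms(1) unfolding fin_supp_def by (rule sum.inter_filter[symmetric])
      finally show ?thesis .
    qed
    then show "(\<Sum>u\<in>{u\<in>{u. R u \<noteq> 0}. mset u = M}. R u * \<phi> u) = mset_coeff M R * \<psi> M"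
      by (simp add: sum_distrib_right assms(2))
  qed
  finally show ?thesis .
qed

lemma peval_mset_coeff_zero:
  assumes "fin_supp R" "\<And>M. mset_coeff M R = 0"
  shows "peval R = (\<lambda>_. 0)"
  using lin_mset[OF assms(1), of "\<lambda>w. mon w \<xi>" "\<lambda>M. prod_mset (image_mset (\<lambda>i. \<xi> $ i) M)" for \<xi>]
  by (intro ext) (simp add: peval_eq_lin mon_mset assms(2))

lemma mset_coeff_sg_leading:
  assumes L: "\<And>w. length w \<le> size M \<Longrightarrow> L w = of_bool (mset w = M)" and "length u \<le> size M"
  shows "lin L (sym_word u) = of_bool (mset u = M)"
  using assms by (intro lin_sym_word_mset) (metis size_mset)

text \<open>Evaluate the Poincare-Birkhoff-Witt form of a multiset \<open>M0\<close> of maximal size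
  with nonzero coefficient: it sees just that coefficient, yet it vanishes on the ideal. The
  conclusion is about commutative coefficients because \<open>sg\<close> identifies permuted
  words.\<close>

lemma sg_injective:
  assumes lie: "lie_sc c" and R: "fin_supp R" and I: "sg R \<in> uideal c"
  shows "mset_coeff M R = 0"
proof (rule ccontr)
  assume "mset_coeff M R \<noteq> 0"
  let ?S = "{M. mset_coeff M R \<noteq> 0}"
  have "?S \<subseteq> mset ` {u. R u \<noteq> 0}"
  proof
    fix M assume "M \<in> ?S"
    then obtain u where "R u * of_bool (mset u = M) \<noteq> 0"
      unfolding mset_coeff_def lin_def by (blast elim: sum.not_neutral_contains_not_neutral)
    then show "M \<in> mset ` {u. R u \<noteq> 0}" by (auto split: if_splits)
  qed
  then have "finite ?S" using R finite_surj unfolding fin_supp_def by blast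
  then obtain M0 where M0: "mset_coeff M0 R \<noteq> 0" and max: "\<And>M. mset_coeff M R \<noteq> 0 \<Longrightarrow> size M \<le> size M0"
  proof -
    have "Max (size ` ?S) \<in> size ` ?S"
      using \<open>finite ?S\<close> \<open>mset_coeff M R \<noteq> 0\<close> by (intro Max_in) auto
    then obtain M0 where "M0 \<in> ?S" "size M0 = Max (size ` ?S)" by force
    then show ?thesis using \<open>finite ?S\<close> by (intro that[of M0]) auto
  qed
  obtain L where rel: "\<And>u a b v. L (u @ [a, b] @ v) = L (u @ [b, a] @ v) + (\<Sum>k\<in>UNIV. c k a b * L (u @ [k] @ v))"
    and L: "\<And>w. length w \<le> size M0 \<Longrightarrow> L w = of_bool (mset w = M0)"
    by (rule poincare_birkhoff_witt[OF lie, where M = M0]) (blast intro: that)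
  \<comment> \<open>The value of \<open>L\<close> on a symmetrized word depends only on the
    multiset, so any representative serves.\<close>
  define \<psi> where "\<psi> M = lin L (sym_word (SOME u. mset u = M))" for M
  have \<psi>: "lin L (sym_word u) = \<psi> (mset u)" for u
  proof -
    have "mset (SOME v. mset v = mset u) = mset u" by (rule someI) simp
    then show ?thesis unfolding \<psi>_def using sym_word_mset by metis
  qed
  have \<psi>_small: "\<psi> M = of_bool (M = M0)" if "size M \<le> size M0" for M
  proof -
    obtain u where "mset u = M" using ex_mset by blast
    then show ?thesis using mset_coeff_sg_leading[OF L, of u] that \<psi>[of u] by auto
  qed
  have "0 = lin L (sg R)" using uideal_lin[OF rel I] by simp
  also have "\<dots> = (\<Sum>M\<in>mset ` {u. R u \<noteq> 0}. mset_coeff M R * \<psi> M)"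
    unfolding lin_sg by (rule lin_mset[OF R]) (rule \<psi>)
  \<comment> \<open>Larger multisets have coefficient 0 by maximality of \<open>M0\<close>; on the
    others \<open>\<psi>\<close> is known.\<close>
  also have "\<dots> = (\<Sum>M\<in>mset ` {u. R u \<noteq> 0}. mset_coeff M R * of_bool (M = M0))"
    using max \<psi>_small by (intro sum.cong refl) (metis mult_eq_0_iff)
  also have "\<dots> = lin (\<lambda>u. of_bool (mset u = M0)) R"
    by (rule lin_mset[OF R, symmetric]) simp
  also have "\<dots> = mset_coeff M0 R" by (simp add: mset_coeff_def)
  finally show False using M0 by simp
qed

section \<open>Smooth functions on coordinate space\<close>

lemma smooth_continuous: "smooth f \<Longrightarrow> continuous_on UNIV f"
  unfolding smooth_def by (metis dpd.simps(1))

lemma pd_eqI: "((\<lambda>t. f (x + t *\<^sub>R axis i 1)) has_real_derivative d) (at 0) \<Longrightarrow> pd i f x = d"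
  by (simp add: pd_def DERIV_imp_deriv)

lemma smooth_line_derivative:
  assumes "smooth f"
  shows "((\<lambda>t. f (x + t *\<^sub>R axis i 1)) has_real_derivative pd i f x) (at 0)"
proof -
  have "(\<lambda>t. dpd [] f (x + t *\<^sub>R axis i 1)) differentiable (at 0)"
    using assms unfolding smooth_def by blast
  then show ?thesis by (simp add: pd_def DERIV_deriv_iff_real_differentiable)
qed

lemma smooth_line_derivative_at:
  assumes "smooth f"
  shows "((\<lambda>t. f (x + t *\<^sub>R axis i 1)) has_real_derivative pd i f (x + s *\<^sub>R axis i 1)) (at s)"
proof -
  have "((\<lambda>t. f ((x + s *\<^sub>R axis i 1) + t *\<^sub>R axis i 1)) has_real_derivative pd i f (x + s *\<^sub>R axis i 1)) (at 0)"
    by (rule smooth_line_derivative[OF assms])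
  then have "((\<lambda>t. f (x + (t + s) *\<^sub>R axis i 1)) has_real_derivative pd i f (x + s *\<^sub>R axis i 1)) (at 0)"
    by (simp add: algebra_simps)
  then show ?thesis
    using DERIV_shift[of "\<lambda>t. f (x + t *\<^sub>R axis i 1)" _ 0 s] by simp
qed

lemma dpd_append: "dpd (u @ v) f = dpd u (dpd v f)"
  by (induction u) auto

lemma smooth_dpd: "smooth f \<Longrightarrow> smooth (dpd w f)"
  unfolding smooth_def by (simp flip: dpd_append)

lemma smooth_pd: "smooth f \<Longrightarrow> smooth (pd i f)"
  using smooth_dpd[of f "[i]"] by simp

text \<open>\<open>smooth\<close> demands continuity and differentiability along the axes of every
  iterated derivative, so it contains any class with these two properties that is closed under
  \<open>pd\<close>.\<close>

lemma smooth_coinduct: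
  assumes "S f"
    and cont: "\<And>f. S f \<Longrightarrow> continuous_on UNIV f"
    and deriv: "\<And>f i x. S f \<Longrightarrow> ((\<lambda>t. f (x + t *\<^sub>R axis i 1)) has_real_derivative pd i f x) (at 0)"
    and pd: "\<And>f i. S f \<Longrightarrow> S (pd i f)"
  shows "smooth f"
proof -
  have S: "S (dpd w f)" for w by (induction w) (auto intro: assms)
  show ?thesis
    unfolding smooth_def using cont[OF S] deriv[OF S] real_differentiable_def by blast
qed

lemma pd_add: "smooth f \<Longrightarrow> smooth g \<Longrightarrow> pd i (\<lambda>x. f x + g x) = (\<lambda>x. pd i f x + pd i g x)"
  by (intro ext pd_eqI DERIV_add smooth_line_derivative)

lemma pd_mult:
  "smooth f \<Longrightarrow> smooth g \<Longrightarrow> pd i (\<lambda>x. f x * g x) = (\<lambda>x. pd i f x * g x + f x * pd i g x)"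
  by (intro ext pd_eqI) (auto intro!: derivative_eq_intros smooth_line_derivative)

lemma pd_const: "pd i (\<lambda>_. a) = (\<lambda>_. 0)"
  by (intro ext pd_eqI) auto

lemma pd_coordinate: "pd i (\<lambda>\<xi>. \<xi> $ j) = (\<lambda>_. of_bool (i = j))"
  by (intro ext pd_eqI) (auto intro!: derivative_eq_intros simp: axis_def)

lemma smooth_const [simp]: "smooth (\<lambda>_. a)"
  by (rule smooth_coinduct[of "\<lambda>f. \<exists>a. f = (\<lambda>_. a)"]) (auto simp: pd_const)

lemma smooth_coordinate [simp]:
  fixes j :: "'n::finite"
  shows "smooth (\<lambda>\<xi>. \<xi> $ j)"
proof (rule smooth_coinduct[of "\<lambda>f. f = (\<lambda>\<xi>. \<xi> $ j) \<or> (\<exists>a. f = (\<lambda>_. a))"])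
  fix f :: "real^'n \<Rightarrow> real" and i x
  assume "f = (\<lambda>\<xi>. \<xi> $ j) \<or> (\<exists>a. f = (\<lambda>_. a))"
  then show "((\<lambda>t. f (x + t *\<^sub>R axis i 1)) has_real_derivative pd i f x) (at 0)"
    by (auto intro!: derivative_eq_intros simp: axis_def pd_const pd_coordinate)
qed (auto simp: pd_const pd_coordinate intro!: continuous_intros)

text \<open>The derivative of a product is a sum of products, so products alone do not form a class
  closed under \<open>pd\<close>; sums and products together do.\<close>

inductive smooth_alg :: "(real^'n::finite \<Rightarrow> real) \<Rightarrow> bool" where
  base: "smooth f \<Longrightarrow> smooth_alg f"
| add: "smooth_alg f \<Longrightarrow> smooth_alg g \<Longrightarrow> smooth_alg (\<lambda>x. f x + g x)"
| mult: "smooth_alg f \<Longrightarrow> smooth_alg g \<Longrightarrow> smooth_alg (\<lambda>x. f x * g x)"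

lemma smooth_alg_smooth: "smooth_alg f \<Longrightarrow> smooth f"
proof (rule smooth_coinduct[of smooth_alg])
  fix f :: "real^'n::finite \<Rightarrow> real"
  assume f: "smooth_alg f"
  show "continuous_on UNIV f"
    using f by induction (auto intro: smooth_continuous continuous_intros)
  have both: "(\<forall>x. ((\<lambda>t. f (x + t *\<^sub>R axis i 1)) has_real_derivative pd i f x) (at 0))
      \<and> smooth_alg (pd i f)" for i
    using f
  proof induction
    case (base f)
    then show ?case by (auto intro: smooth_line_derivative smooth_alg.base smooth_pd)
  next
    case (add f g)
    then have "((\<lambda>t. f (x + t *\<^sub>R axis i 1) + g (x + t *\<^sub>R axis i 1))
        has_real_derivative (pd i f x + pd i g x)) (at 0)" for x
      by (intro DERIV_add) auto
    then show ?case using add pd_eqI[of "\<lambda>x. f x + g x"]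
      by (auto intro!: smooth_alg.add simp: fun_eq_iff ext[of "pd i (\<lambda>x. f x + g x)" "\<lambda>x. pd i f x + pd i g x"])
  next
    case (mult f g)
    have d: "((\<lambda>t. f (x + t *\<^sub>R axis i 1) * g (x + t *\<^sub>R axis i 1))
        has_real_derivative (pd i f x * g x + f x * pd i g x)) (at 0)" for x
      using DERIV_mult[of "\<lambda>t. f (x + t *\<^sub>R axis i 1)" "pd i f x" 0 UNIV
        "\<lambda>t. g (x + t *\<^sub>R axis i 1)" "pd i g x"] mult
      by (simp add: mult.commute)
    have e: "pd i (\<lambda>x. f x * g x) = (\<lambda>x. pd i f x * g x + f x * pd i g x)"
      by (intro ext pd_eqI d)
    show ?case using d mult unfolding e by (auto intro!: smooth_alg.add smooth_alg.mult)
  qed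
  then show "((\<lambda>t. f (x + t *\<^sub>R axis i 1)) has_real_derivative pd i f x) (at 0)"
    "smooth_alg (pd i f)" for i x by auto
qed

lemma smooth_add [simp]: "smooth f \<Longrightarrow> smooth g \<Longrightarrow> smooth (\<lambda>x. f x + g x)"
  by (auto intro: smooth_alg_smooth smooth_alg.intros)

lemma smooth_mult [simp]: "smooth f \<Longrightarrow> smooth g \<Longrightarrow> smooth (\<lambda>x. f x * g x)"
  by (auto intro: smooth_alg_smooth smooth_alg.intros)

lemma smooth_sum [simp]: "(\<And>i. i \<in> I \<Longrightarrow> smooth (f i)) \<Longrightarrow> smooth (\<lambda>x. \<Sum>i\<in>I. f i x)"
  by (induction I rule: infinite_finite_induct) auto

lemma smooth_mon [simp]: "smooth (mon w)"
  by (induction w) auto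

lemma dpd_add: "smooth f \<Longrightarrow> smooth g \<Longrightarrow> dpd w (\<lambda>x. f x + g x) = (\<lambda>x. dpd w f x + dpd w g x)"
  by (induction w) (auto simp: pd_add smooth_dpd)

lemma pd_scale: "smooth f \<Longrightarrow> pd i (\<lambda>x. a * f x) = (\<lambda>x. a * pd i f x)"
  by (simp add: pd_mult pd_const)

lemma dpd_scale: "smooth f \<Longrightarrow> dpd w (\<lambda>x. a * f x) = (\<lambda>x. a * dpd w f x)"
  by (induction w) (auto simp: pd_scale smooth_dpd)

lemma dpd_diff: "smooth f \<Longrightarrow> smooth g \<Longrightarrow> dpd w (\<lambda>x. f x - g x) = (\<lambda>x. dpd w f x - dpd w g x)"
  using dpd_add[of f "\<lambda>x. -1 * g x" w] dpd_scale[of g w "-1"] smooth_mult[of "\<lambda>_. -1" g] by simp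

lemma smooth_diff [simp]: "smooth f \<Longrightarrow> smooth g \<Longrightarrow> smooth (\<lambda>x. f x - g x)"
  using smooth_add[of f "\<lambda>x. -1 * g x"] smooth_mult[of "\<lambda>_. -1" g] by simp

text \<open>Two applications of the mean value theorem: along \<open>i\<close> to the increment in
  direction \<open>j\<close>, then along \<open>j\<close>.\<close>

lemma second_difference:
  fixes f :: "real^'n::finite \<Rightarrow> real"
  assumes "smooth f" "h > 0"
  obtains s t where "0 < s" "s < h" "0 < t" "t < h"
    "f (x + h *\<^sub>R axis i 1 + h *\<^sub>R axis j 1) - f (x + h *\<^sub>R axis i 1) - f (x + h *\<^sub>R axis j 1) + f x
     = h * h * pd j (pd i f) (x + s *\<^sub>R axis i 1 + t *\<^sub>R axis j 1)"
proof -
  let ?i = "axis i 1 :: real^'n" and ?j = "axis j 1 :: real^'n"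
  define \<phi> where "\<phi> s = f ((x + h *\<^sub>R ?j) + s *\<^sub>R ?i) - f (x + s *\<^sub>R ?i)" for s
  have "(\<phi> has_real_derivative pd i f ((x + h *\<^sub>R ?j) + s *\<^sub>R ?i) - pd i f (x + s *\<^sub>R ?i)) (at s)" for s
    unfolding \<phi>_def by (intro DERIV_diff smooth_line_derivative_at assms)
  then obtain s where s: "0 < s" "s < h"
    "\<phi> h - \<phi> 0 = (h - 0) * (pd i f ((x + h *\<^sub>R ?j) + s *\<^sub>R ?i) - pd i f (x + s *\<^sub>R ?i))"
    using MVT2[OF \<open>h > 0\<close>, of \<phi> "\<lambda>s. pd i f ((x + h *\<^sub>R ?j) + s *\<^sub>R ?i) - pd i f (x + s *\<^sub>R ?i)"]
    by blast
  define \<psi> where "\<psi> t = pd i f ((x + s *\<^sub>R ?i) + t *\<^sub>R ?j)" for t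
  have "(\<psi> has_real_derivative pd j (pd i f) ((x + s *\<^sub>R ?i) + t *\<^sub>R ?j)) (at t)" for t
    unfolding \<psi>_def by (intro smooth_line_derivative_at smooth_pd assms)
  then obtain t where t: "0 < t" "t < h"
    "\<psi> h - \<psi> 0 = (h - 0) * pd j (pd i f) ((x + s *\<^sub>R ?i) + t *\<^sub>R ?j)"
    using MVT2[OF \<open>h > 0\<close>, of \<psi> "\<lambda>t. pd j (pd i f) ((x + s *\<^sub>R ?i) + t *\<^sub>R ?j)"]
    by blast
  have "\<phi> h - \<phi> 0 = h * (\<psi> h - \<psi> 0)"
    unfolding s(3) \<psi>_def by (simp add: algebra_simps)
  with t(3) show ?thesis
    by (intro that[OF s(1,2) t(1,2)]) (simp add: \<phi>_def algebra_simps)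
qed

text \<open>The second difference is symmetric in \<open>i\<close> and \<open>j\<close>, so the two
  mixed derivatives agree at a pair of points near \<open>x\<close>; shrink the step and use
  continuity.\<close>

lemma pd_commute:
  fixes f :: "real^'n::finite \<Rightarrow> real"
  assumes "smooth f"
  shows "pd i (pd j f) = pd j (pd i f)"
proof
  fix x
  let ?i = "axis i 1 :: real^'n" and ?j = "axis j 1 :: real^'n"
  let ?h = "\<lambda>n. inverse (real (Suc n))"
  have "\<exists>s t s' t'. (0 < s \<and> s < ?h n) \<and> (0 < t \<and> t < ?h n) \<and> (0 < s' \<and> s' < ?h n) \<and> (0 < t' \<and> t' < ?h n) \<and>
     pd j (pd i f) (x + s *\<^sub>R ?i + t *\<^sub>R ?j) = pd i (pd j f) (x + s' *\<^sub>R ?j + t' *\<^sub>R ?i)" for n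
  proof -
    have h: "?h n > 0" by simp
    obtain s t where 1: "0 < s" "s < ?h n" "0 < t" "t < ?h n"
      "f (x + ?h n *\<^sub>R ?i + ?h n *\<^sub>R ?j) - f (x + ?h n *\<^sub>R ?i) - f (x + ?h n *\<^sub>R ?j) + f x
       = ?h n * ?h n * pd j (pd i f) (x + s *\<^sub>R ?i + t *\<^sub>R ?j)"
      using second_difference[OF assms h] by metis
    obtain s' t' where 2: "0 < s'" "s' < ?h n" "0 < t'" "t' < ?h n"
      "f (x + ?h n *\<^sub>R ?j + ?h n *\<^sub>R ?i) - f (x + ?h n *\<^sub>R ?j) - f (x + ?h n *\<^sub>R ?i) + f x
       = ?h n * ?h n * pd i (pd j f) (x + s' *\<^sub>R ?j + t' *\<^sub>R ?i)"
      using second_difference[OF assms h] by metis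
    have "?h n * ?h n * pd j (pd i f) (x + s *\<^sub>R ?i + t *\<^sub>R ?j)
        = ?h n * ?h n * pd i (pd j f) (x + s' *\<^sub>R ?j + t' *\<^sub>R ?i)"
      unfolding 1(5)[symmetric] 2(5)[symmetric] by (simp add: algebra_simps)
    then have "pd j (pd i f) (x + s *\<^sub>R ?i + t *\<^sub>R ?j) = pd i (pd j f) (x + s' *\<^sub>R ?j + t' *\<^sub>R ?i)"
      using h by (metis mult_cancel_left mult_pos_pos less_irrefl)
    with 1 2 show ?thesis by blast
  qed
  then obtain s t s' t' where st: "\<And>n. 0 < s n \<and> s n < ?h n" "\<And>n. 0 < t n \<and> t n < ?h n"
      "\<And>n. 0 < s' n \<and> s' n < ?h n" "\<And>n. 0 < t' n \<and> t' n < ?h n"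
    and eq: "\<And>n. pd j (pd i f) (x + s n *\<^sub>R ?i + t n *\<^sub>R ?j) = pd i (pd j f) (x + s' n *\<^sub>R ?j + t' n *\<^sub>R ?i)"
    by metis
  have null: "r \<longlonglongrightarrow> 0" if "\<And>n. 0 < r n \<and> r n < ?h n" for r
    by (rule tendsto_sandwich[OF _ _ tendsto_const LIMSEQ_inverse_real_of_nat])
       (use that in \<open>auto intro!: always_eventually less_imp_le\<close>)
  have "(\<lambda>n. x + s n *\<^sub>R ?i + t n *\<^sub>R ?j) \<longlonglongrightarrow> x + 0 *\<^sub>R ?i + 0 *\<^sub>R ?j"
       "(\<lambda>n. x + s' n *\<^sub>R ?j + t' n *\<^sub>R ?i) \<longlonglongrightarrow> x + 0 *\<^sub>R ?j + 0 *\<^sub>R ?i"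
    by (intro tendsto_intros null st)+
  moreover have "isCont (pd j (pd i f)) x" "isCont (pd i (pd j f)) x"
    using smooth_continuous[OF smooth_pd[OF smooth_pd[OF assms]]]
    by (auto simp: continuous_on_eq_continuous_at)
  ultimately have "(\<lambda>n. pd j (pd i f) (x + s n *\<^sub>R ?i + t n *\<^sub>R ?j)) \<longlonglongrightarrow> pd j (pd i f) x"
      "(\<lambda>n. pd i (pd j f) (x + s' n *\<^sub>R ?j + t' n *\<^sub>R ?i)) \<longlonglongrightarrow> pd i (pd j f) x"
    by (auto intro: isCont_tendsto_compose)
  then show "pd i (pd j f) x = pd j (pd i f) x"
    unfolding eq by (rule LIMSEQ_unique[rotated])
qed

lemma dpd_pd: "smooth f \<Longrightarrow> dpd w (pd i f) = pd i (dpd w f)"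
  by (induction w) (auto simp: pd_commute smooth_dpd)

section \<open>Density of polynomials\<close>

lemma polyfun_zero [simp]: "polyfun (\<lambda>_. 0)"
  unfolding polyfun_def by (rule exI[of _ "\<lambda>_. 0"]) (auto simp: peval_eq_lin)

lemma polyfun_mon [simp]: "polyfun (mon w)"
  unfolding polyfun_def by (rule exI[of _ "word w"]) (auto simp: peval_eq_lin)

lemma polyfun_coordinate [simp]: "polyfun (\<lambda>\<xi>. \<xi> $ i)"
  using polyfun_mon[of "[i]"] by simp

lemma polyfun_add [simp]: "polyfun p \<Longrightarrow> polyfun q \<Longrightarrow> polyfun (\<lambda>x. p x + q x)"
  unfolding polyfun_def
  by (elim exE conjE, rule_tac x="\<lambda>w. P w + Pa w" in exI) (auto simp: peval_eq_lin)

lemma polyfun_mult [simp]: "polyfun p \<Longrightarrow> polyfun q \<Longrightarrow> polyfun (\<lambda>x. p x * q x)"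
  unfolding polyfun_def
  by (elim exE conjE, rule_tac x="wmult P Pa" in exI) (auto simp: peval_wmult)

lemma polyfun_const [simp]: "polyfun (\<lambda>_. a)"
  unfolding polyfun_def by (rule exI[of _ "\<lambda>w. a * word [] w"]) (auto simp: peval_eq_lin)

lemma polyfun_induct [consumes 1, case_names zero add]:
  assumes "polyfun p" and "P (\<lambda>_. 0)"
    and "\<And>p r w. polyfun p \<Longrightarrow> P p \<Longrightarrow> P (\<lambda>x. p x + r * mon w x)"
  shows "P p"
proof -
  obtain Q where "fin_supp Q" "p = peval Q" using assms(1) by (auto simp: polyfun_def)
  have "polyfun (peval Q) \<and> P (peval Q)" using \<open>fin_supp Q\<close>
  proof (induction Q rule: fin_supp_induct)
    case (add a r u)
    then have "peval (\<lambda>w. a w + r * word u w) = (\<lambda>x. peval a x + r * mon u x)"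
      by (auto simp: peval_eq_lin)
    then show ?case using assms(3)[of "peval a" r u] add by simp
  qed (use assms(2) in \<open>simp add: peval_eq_lin[abs_def]\<close>)
  then show ?thesis using \<open>p = peval Q\<close> by simp
qed

lemma smooth_polyfun: "polyfun p \<Longrightarrow> smooth p"
  by (induction p rule: polyfun_induct) auto

lemma polyfun_sum [simp]: "(\<And>i. i \<in> I \<Longrightarrow> polyfun (f i)) \<Longrightarrow> polyfun (\<lambda>x. \<Sum>i\<in>I. f i x)"
  by (induction I rule: infinite_finite_induct) auto

lemma polyfun_real_polynomial_function:
  fixes p :: "real^'n::finite \<Rightarrow> real"
  assumes "real_polynomial_function p"
  shows "polyfun p"
  using assms
proof induction
  case (linear f)
  have "f = (\<lambda>x. \<Sum>i\<in>UNIV. f (axis i 1) * mon [i] x)"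
  proof
    fix x
    interpret bounded_linear f by (rule linear)
    have "f x = f (\<Sum>i\<in>UNIV. x $ i *\<^sub>R axis i 1)"
      using basis_expansion[of x] by (simp add: scalar_mult_eq_scaleR)
    then show "f x = (\<Sum>i\<in>UNIV. f (axis i 1) * mon [i] x)"
      by (simp add: sum scaleR mult.commute)
  qed
  moreover have "polyfun (\<lambda>x. \<Sum>i\<in>UNIV. f (axis i 1) * mon [i] x)"
    by (intro polyfun_sum polyfun_mult) auto
  ultimately show ?case by simp
qed auto

section \<open>Integrating and restricting polynomials in one coordinate\<close>

lemma euler_mon: "x $ i * pd i (mon w) x = real (count (mset w) i) * mon w x"
  by (induction w) (auto simp: pd_const pd_mult pd_coordinate algebra_simps)

lemma pd_mon_notin: "i \<notin> set w \<Longrightarrow> pd i (mon w) = (\<lambda>_. 0)"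
  by (induction w) (auto simp: pd_const pd_mult pd_coordinate)

text \<open>Multiply each monomial by the coordinate \<open>i\<close> and divide by one plus its
  exponent there. Vanishing on the hyperplane leaves the boundary values free to be
  prescribed.\<close>

lemma polyfun_primitive:
  "polyfun q \<Longrightarrow> \<exists>p. polyfun p \<and> pd i p = q \<and> (\<forall>x. x $ i = 0 \<longrightarrow> p x = 0)"
proof (induction q rule: polyfun_induct)
  case zero
  show ?case by (rule exI[of _ "\<lambda>_. 0"]) (auto simp: pd_const)
next
  case (add q r w)
  then obtain p where p: "polyfun p" "pd i p = q" "\<forall>x. x $ i = 0 \<longrightarrow> p x = 0" by blast
  let ?a = "r / (1 + real (count (mset w) i))"
  have "pd i (\<lambda>x. p x + ?a * mon (i # w) x) = (\<lambda>x. q x + ?a * (mon w x + x $ i * pd i (mon w) x))"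
    using p smooth_polyfun[OF p(1)]
    by (subst pd_add) (simp_all add: pd_mult pd_const pd_coordinate del: times_divide_eq_left)
  also have "\<dots> = (\<lambda>x. q x + r * mon w x)"
    unfolding euler_mon by (auto simp: field_simps)
  finally show ?case
    using p by (intro exI[of _ "\<lambda>x. p x + ?a * mon (i # w) x"]) (auto simp del: times_divide_eq_left)
qed

text \<open>Substitute 0 for the coordinate \<open>i\<close>: monomials containing \<open>i\<close>
  are dropped, the others are kept.\<close>

lemma polyfun_restrict:
  "polyfun q \<Longrightarrow> \<exists>p. polyfun p \<and> pd i p = (\<lambda>_. 0) \<and> (\<forall>x. x $ i = 0 \<longrightarrow> p x = q x)"
proof (induction q rule: polyfun_induct)
  case zero
  show ?case by (rule exI[of _ "\<lambda>_. 0"]) (auto simp: pd_const)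
next
  case (add q r w)
  then obtain p where p: "polyfun p" "pd i p = (\<lambda>_. 0)" "\<forall>x. x $ i = 0 \<longrightarrow> p x = q x" by blast
  show ?case
  proof (cases "i \<in> set w")
    case True
    then have "mon w x = 0" if "x $ i = 0" for x
      using that by (auto simp: mon_def prod_list_zero_iff)
    then show ?thesis using p by (intro exI[of _ p]) auto
  next
    case False
    then show ?thesis using p smooth_polyfun[OF p(1)]
      by (intro exI[of _ "\<lambda>x. p x + r * mon w x"]) (auto simp: pd_add pd_scale pd_mon_notin)
  qed
qed

text \<open>Directions other than \<open>i\<close> stay inside the hyperplane.\<close>

lemma dpd_hyperplane_cong:
  assumes "\<And>x. x $ i = 0 \<Longrightarrow> f x = g x" "i \<notin> set w" "x $ i = 0"
  shows "dpd w f x = dpd w g x"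
  using assms(2,3)
proof (induction w arbitrary: x)
  case (Cons j w)
  then have "dpd w f (x + t *\<^sub>R axis j 1) = dpd w g (x + t *\<^sub>R axis j 1)" for t
    by (intro Cons.IH) (auto simp: axis_def)
  then show ?case by (simp add: pd_def)
qed (use assms(1) in auto)

definition cube :: "real \<Rightarrow> (real^'n::finite) set" where
  "cube R = {x. \<forall>i. \<bar>x $ i\<bar> \<le> R}"

lemma compact_cube: "compact (cube R)"
proof -
  have "cube R = cbox (\<chi> i. - R) (\<chi> i. R)"
    by (auto simp: cube_def mem_box_cart abs_le_iff minus_le_iff)
  then show ?thesis by (metis compact_cbox)
qed

text \<open>The bound is \<open>e\<close> at the projection of \<open>x\<close> to the hyperplane
  plus \<open>e\<close> times the length, at most \<open>R\<close>, of the segment from there to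
  \<open>x\<close>; this segment stays in the cube.\<close>

lemma cube_mvt:
  fixes u :: "real^'n::finite \<Rightarrow> real"
  assumes u: "smooth u" and x: "x \<in> cube R"
    and d: "\<And>y. y \<in> cube R \<Longrightarrow> \<bar>pd i u y\<bar> \<le> e"
    and b: "\<And>y. y \<in> cube R \<Longrightarrow> y $ i = 0 \<Longrightarrow> \<bar>u y\<bar> \<le> e"
  shows "\<bar>u x\<bar> \<le> e * (1 + R)"
proof -
  define y where "y = x - (x $ i) *\<^sub>R axis i 1"
  define \<phi> where "\<phi> t = u (y + t *\<^sub>R axis i 1)" for t
  have yc: "y + t *\<^sub>R axis i 1 \<in> cube R" if "\<bar>t\<bar> \<le> R" for t
    using x that by (auto simp: cube_def y_def axis_def)
  have R: "\<bar>x $ i\<bar> \<le> R" using x by (auto simp: cube_def)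
  have "norm (\<phi> (x $ i) - \<phi> 0) \<le> e * norm (x $ i - 0)"
  proof (rule field_differentiable_bound)
    show "(\<phi> has_field_derivative pd i u (y + t *\<^sub>R axis i 1)) (at t within {-R..R})" for t
      unfolding \<phi>_def by (intro DERIV_subset[OF smooth_line_derivative_at[OF u]]) auto
    show "norm (pd i u (y + t *\<^sub>R axis i 1)) \<le> e" if "t \<in> {-R..R}" for t
      using d[OF yc] that by auto
  qed (use R in auto)
  also have "\<dots> \<le> e * R"
    using R d[OF x] by (intro mult_left_mono) auto
  finally have "\<bar>\<phi> (x $ i) - \<phi> 0\<bar> \<le> e * R" by simp
  moreover have "\<phi> (x $ i) = u x" "\<bar>\<phi> 0\<bar> \<le> e"
    using b[OF yc[of 0]] R by (auto simp: \<phi>_def y_def)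
  ultimately show ?thesis by (simp add: distrib_left)
qed

text \<open>Induction on the word of derivatives to be controlled: an approximation of \<open>\<partial>\<^sub>i f\<close> is integrated
  in direction \<open>i\<close>, starting from an approximation of \<open>f\<close> on the hyperplane \<open>\<xi>\<^sub>i = 0\<close>.\<close>

lemma polynomial_approximation:
  fixes f :: "real^'n::finite \<Rightarrow> real"
  assumes "smooth f" "e > 0" and R: "R \<ge> 0"
  shows "\<exists>p. polyfun p \<and> (\<forall>w x. mset w \<subseteq># mset u \<longrightarrow> x \<in> cube R \<longrightarrow> \<bar>dpd w f x - dpd w p x\<bar> \<le> e)"
  using assms(1,2)
proof (induction u arbitrary: f e)
  case Nil
  obtain p where "real_polynomial_function p" "\<And>x. x \<in> cube R \<Longrightarrow> \<bar>f x - p x\<bar> < e"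
    using Stone_Weierstrass_real_polynomial_function[OF compact_cube
      continuous_on_subset[OF smooth_continuous[OF Nil(1)]] Nil(2)] by blast
  then show ?case using polyfun_real_polynomial_function[of p] by (intro exI[of _ p]) (auto intro: less_imp_le)
next
  case (Cons i u)
  \<comment> \<open>Dividing by \<open>1 + R\<close> compensates the factor that
    \<open>cube_mvt\<close> costs.\<close>
  define d where "d = e / (1 + R)"
  have d: "d > 0" "d * (1 + R) = e" "d \<le> e" using Cons.prems R by (auto simp: d_def field_simps)
  obtain q where q: "polyfun q"
    "\<And>w x. mset w \<subseteq># mset u \<Longrightarrow> x \<in> cube R \<Longrightarrow> \<bar>dpd w (pd i f) x - dpd w q x\<bar> \<le> d"
    using Cons.IH[OF smooth_pd[OF Cons.prems(1)] d(1)] by blast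
  obtain p0 where p0: "polyfun p0"
    "\<And>w x. mset w \<subseteq># mset u \<Longrightarrow> x \<in> cube R \<Longrightarrow> \<bar>dpd w f x - dpd w p0 x\<bar> \<le> d"
    using Cons.IH[OF Cons.prems(1) d(1)] by blast
  obtain p1 where p1: "polyfun p1" "pd i p1 = q" "\<And>x. x $ i = 0 \<Longrightarrow> p1 x = 0"
    using polyfun_primitive[OF q(1)] by blast
  obtain p2 where p2: "polyfun p2" "pd i p2 = (\<lambda>_. 0)" "\<And>x. x $ i = 0 \<Longrightarrow> p2 x = p0 x"
    using polyfun_restrict[OF p0(1)] by blast
  \<comment> \<open>\<open>p1\<close> supplies the derivative in direction \<open>i\<close>,
    \<open>p2\<close> the values on the hyperplane, where \<open>p1\<close> vanishes.\<close>
  define p where "p = (\<lambda>x. p1 x + p2 x)"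
  have p: "polyfun p" "pd i p = q" "\<And>x. x $ i = 0 \<Longrightarrow> p x = p0 x"
    using p1 p2 smooth_polyfun[OF p1(1)] smooth_polyfun[OF p2(1)] by (auto simp: p_def pd_add)
  note sp = smooth_polyfun[OF p(1)]
  have "\<bar>dpd w f x - dpd w p x\<bar> \<le> e" if w: "mset w \<subseteq># mset (i # u)" and x: "x \<in> cube R" for w x
  \<comment> \<open>If \<open>i\<close> occurs in \<open>w\<close>, one copy moves to the innermost
    place and the claim is the one for the derivative of \<open>f\<close>. Otherwise only tangential
    derivatives are taken on the hyperplane, and the error is integrated from there.\<close>
  proof (cases "i \<in> set w")
    case True
    then obtain w1 w2 where w12: "w = w1 @ i # w2" by (meson split_list)
    have eq: "dpd w g = dpd (w1 @ w2) (pd i g)" if "smooth g" for g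
      using that by (simp add: w12 dpd_append dpd_pd)
    have "mset (w1 @ w2) \<subseteq># mset u" using w by (simp add: w12)
    from q(2)[OF this x] show ?thesis
      unfolding eq[OF Cons.prems(1)] eq[OF sp] p(2) using d(3) by linarith
  next
    case False
    have wu: "mset w \<subseteq># mset u"
    proof (rule mset_subset_eqI)
      fix a
      show "count (mset w) a \<le> count (mset u) a"
      proof (cases "a = i")
        case True
        have "count (mset w) i = 0" using \<open>i \<notin> set w\<close> by simp
        with True show ?thesis by (simp only: le0)
      next
        case False
        then show ?thesis using mset_subset_eq_count[OF w, of a] by simp
      qed
    qed
    let ?u = "\<lambda>x. dpd w f x - dpd w p x"
    have "\<bar>?u x\<bar> \<le> d * (1 + R)"
    proof (rule cube_mvt[of _ x R i])
      show "smooth ?u" using Cons.prems(1) sp by (simp add: smooth_dpd)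
      fix y :: "real^'n" assume y: "y \<in> cube R"
      have "pd i ?u = (\<lambda>y. dpd w (pd i f) y - dpd w q y)"
        using dpd_diff[of "dpd w f" "dpd w p" "[i]"] Cons.prems(1) sp
        by (simp add: smooth_dpd p(2)[symmetric] dpd_pd)
      then show "\<bar>pd i ?u y\<bar> \<le> d" using q(2)[OF wu y] by simp
      show "\<bar>?u y\<bar> \<le> d" if "y $ i = 0"
        using p0(2)[OF wu y] dpd_hyperplane_cong[of i p p0 w y] p(3) False that by simp
    qed (rule x)
    then show ?thesis using d by simp
  qed
  then show ?case using p(1) by blast
qed

text \<open>A diagonal choice: the m-th polynomial is within 1/(m+1) of \<open>f\<close> on the m-th
  cube in all derivatives of order at most m.\<close>

lemma polynomials_dense:
  fixes f :: "real^'n::finite \<Rightarrow> real"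
  assumes "smooth f"
  obtains p where "\<forall>m. polyfun (p m)" "cinf_conv p f"
proof -
  obtain L :: "'n list" where L: "set L = UNIV" using finite_list[of "UNIV :: 'n set"] by auto
  \<comment> \<open>Containing each index at least m times, \<open>U m\<close> dominates every word
    of length at most m as a multiset.\<close>
  define U where "U m = concat (replicate m L)" for m
  have count_U: "m \<le> count (mset (U m)) i" for m i
  proof (induction m)
    case (Suc m)
    have "i \<in># mset L" using L by simp
    then have "count (mset L) i > 0" by (simp only: count_greater_zero_iff)
    moreover have "count (mset (U (Suc m))) i = count (mset L) i + count (mset (U m)) i"
      by (simp add: U_def)
    ultimately show ?case using Suc by linarith
  qed simp
  have U: "mset w \<subseteq># mset (U m)" if "length w \<le> m" for w m
    unfolding subseteq_mset_def using count_U[of m] count_le_length[of w] that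
    by (metis count_mset le_trans)
  have "\<forall>m. \<exists>p. polyfun p \<and> (\<forall>w x. mset w \<subseteq># mset (U m) \<longrightarrow> x \<in> cube (real m) \<longrightarrow>
      \<bar>dpd w f x - dpd w p x\<bar> \<le> inverse (real (Suc m)))"
    by (intro allI polynomial_approximation assms) auto
  then obtain p where p: "\<And>m. polyfun (p m)" "\<And>m w x. mset w \<subseteq># mset (U m) \<Longrightarrow> x \<in> cube (real m) \<Longrightarrow>
      \<bar>dpd w f x - dpd w (p m) x\<bar> \<le> inverse (real (Suc m))"
    by metis
  have "cinf_conv p f"
    unfolding cinf_conv_def
  proof (intro allI impI uniform_limitI)
    fix w :: "'n list" and K :: "(real^'n) set" and e :: real
    assume "compact K" "e > 0"
    obtain B where B: "\<And>x. x \<in> K \<Longrightarrow> norm x \<le> B"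
      using compact_imp_bounded[OF \<open>compact K\<close>] by (auto simp: bounded_iff)
    obtain m0 where m0: "inverse (real (Suc m0)) < e" using reals_Archimedean[OF \<open>e > 0\<close>] by blast
    obtain m1 where m1: "B \<le> real m1" using real_arch_simple by blast
    show "\<forall>\<^sub>F m in sequentially. \<forall>x\<in>K. dist (dpd w (p m) x) (dpd w f x) < e"
      using eventually_ge_at_top[of "max (length w) (max m0 m1)"]
    proof eventually_elim
      case (elim m)
      show ?case
      proof
        fix x assume "x \<in> K"
        have "x \<in> cube (real m)"
          unfolding cube_def
        proof safe
          fix i
          show "\<bar>x $ i\<bar> \<le> real m"
            using component_le_norm_cart[of x i] B[OF \<open>x \<in> K\<close>] m1 elim by simp
        qed
        then have "\<bar>dpd w f x - dpd w (p m) x\<bar> \<le> inverse (real (Suc m))"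
          using elim by (intro p(2) U) auto
        also have "\<dots> \<le> inverse (real (Suc m0))" using elim by (simp add: field_simps)
        finally show "dist (dpd w (p m) x) (dpd w f x) < e"
          using m0 by (simp add: dist_real_def abs_minus_commute)
      qed
    qed
  qed
  with p(1) show ?thesis by (intro that) simp_all
qed

section \<open>Continuous linear operators on smooth functions\<close>

lemma cinf_conv_uniform_limit:
  assumes "cinf_conv p f" "compact K"
  shows "uniform_limit K p f sequentially"
proof -
  have "uniform_limit K (\<lambda>m. dpd [] (p m)) (dpd [] f) sequentially"
    using assms(1) unfolding cinf_conv_def by (elim allE) (erule mp, rule assms(2))
  then show ?thesis by simp
qed

lemma cinf_conv_pointwise: "cinf_conv p f \<Longrightarrow> (\<lambda>m. p m x) \<longlonglongrightarrow> f x"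
  by (rule tendsto_uniform_limitI[OF cinf_conv_uniform_limit[of p f "{x}"]]) auto

lemma cinf_conv_pd: "cinf_conv p f \<Longrightarrow> cinf_conv (\<lambda>m. pd i (p m)) (pd i f)"
proof -
  have "dpd w (pd i h) = dpd (w @ [i]) h" for w and h :: "real^'a \<Rightarrow> real"
    by (simp add: dpd_append)
  then show "cinf_conv p f \<Longrightarrow> ?thesis" unfolding cinf_conv_def by (simp del: dpd_append)
qed

lemma cinf_conv_const: "cinf_conv (\<lambda>_. f) f"
  unfolding cinf_conv_def by (auto intro: uniform_limit_const)

lemma cinf_conv_add:
  assumes "\<And>m. smooth (p m)" "smooth f" "cinf_conv p f"
    and "\<And>m. smooth (q m)" "smooth g" "cinf_conv q g"
  shows "cinf_conv (\<lambda>m x. p m x + q m x) (\<lambda>x. f x + g x)"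
  using assms unfolding cinf_conv_def by (auto simp: dpd_add intro!: uniform_limit_add)

text \<open>Induction from the inner end of the word, so that the product rule applies to the
  innermost derivative and its two terms are again products of convergent sequences. At the empty
  word, boundedness of the limits on \<open>K\<close> is what makes the products converge
  uniformly.\<close>

lemma cinf_conv_mult:
  fixes f g :: "real^'n::finite \<Rightarrow> real"
  assumes "\<And>m. smooth (p m)" "smooth f" "cinf_conv p f"
    and "\<And>m. smooth (q m)" "smooth g" "cinf_conv q g"
  shows "cinf_conv (\<lambda>m x. p m x * q m x) (\<lambda>x. f x * g x)"
proof -
  have "uniform_limit K (\<lambda>m. dpd w (\<lambda>x. p m x * q m x)) (dpd w (\<lambda>x. f x * g x)) sequentially"
    if K: "compact K" for K w
    using assms
  proof (induction w arbitrary: p f q g rule: rev_induct)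
    case Nil
    have bounded: "bounded (h ` K)" if "smooth h" for h :: "real^'n \<Rightarrow> real"
      by (rule compact_imp_bounded[OF compact_continuous_image[OF _ K]])
         (rule continuous_on_subset[OF smooth_continuous[OF that]], simp)
    have "uniform_limit K p f sequentially" "uniform_limit K q g sequentially"
      using Nil(3,6) K by (simp_all add: cinf_conv_uniform_limit)
    then show ?case using Nil(2,5) by (simp add: uniform_lim_mult bounded)
  next
    case (snoc i w)
    have "uniform_limit K (\<lambda>m x. dpd w (\<lambda>x. pd i (p m) x * q m x) x + dpd w (\<lambda>x. p m x * pd i (q m) x) x)
      (\<lambda>x. dpd w (\<lambda>x. pd i f x * g x) x + dpd w (\<lambda>x. f x * pd i g x) x) sequentially"
      using snoc.prems by (intro uniform_limit_add snoc.IH) (simp_all add: smooth_pd cinf_conv_pd)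
    then show ?case
      using snoc.prems by (simp add: dpd_append pd_mult dpd_add smooth_pd)
  qed
  then show ?thesis unfolding cinf_conv_def by blast
qed

text \<open>Sequentially continuous linear operators on smooth functions. Star products and Poisson
  brackets are of this kind in each argument, which reduces their identities to monomials.\<close>

definition oper :: "((real^'n::finite \<Rightarrow> real) \<Rightarrow> real^'n \<Rightarrow> real) \<Rightarrow> bool" where
  "oper T \<longleftrightarrow> (\<forall>f. smooth f \<longrightarrow> smooth (T f)) \<and>
     (\<forall>f g a. smooth f \<longrightarrow> smooth g \<longrightarrow> T (\<lambda>x. f x + a * g x) = (\<lambda>x. T f x + a * T g x)) \<and>
     (\<forall>p f. (\<forall>m. smooth (p m)) \<longrightarrow> smooth f \<longrightarrow> cinf_conv p f \<longrightarrow> cinf_conv (\<lambda>m. T (p m)) (T f))"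

lemma oper_smooth: "oper T \<Longrightarrow> smooth f \<Longrightarrow> smooth (T f)"
  by (simp add: oper_def)

lemma oper_add_scale:
  "oper T \<Longrightarrow> smooth f \<Longrightarrow> smooth g \<Longrightarrow> T (\<lambda>x. f x + a * g x) = (\<lambda>x. T f x + a * T g x)"
  by (simp add: oper_def)

lemma oper_continuous:
  "oper T \<Longrightarrow> (\<And>m. smooth (p m)) \<Longrightarrow> smooth f \<Longrightarrow> cinf_conv p f \<Longrightarrow> cinf_conv (\<lambda>m. T (p m)) (T f)"
  by (simp add: oper_def)

text \<open>Needed since \<open>C r\<close> is given by a differential expression on smooth
  functions only.\<close>

lemma oper_cong:
  assumes "oper T" "\<And>f. smooth f \<Longrightarrow> S f = T f"
  shows "oper S"
  using assms(1) unfolding oper_def by (simp add: assms(2))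

lemma oper_id: "oper (\<lambda>f. f)"
  by (simp add: oper_def)

lemma oper_pd: "oper (pd i)"
  by (simp add: oper_def smooth_pd pd_add pd_scale cinf_conv_pd)

lemma oper_comp: "oper S \<Longrightarrow> oper T \<Longrightarrow> oper (\<lambda>f. S (T f))"
  by (simp add: oper_def)

lemma oper_dpd: "oper (dpd w)"
proof (induction w)
  case (Cons i w)
  show ?case using oper_comp[OF oper_pd Cons] by simp
qed (simp add: oper_id)

lemma oper_zero: "oper (\<lambda>f _. 0)"
  by (simp add: oper_def cinf_conv_const)

lemma oper_mult: "smooth h \<Longrightarrow> oper T \<Longrightarrow> oper (\<lambda>f x. h x * T f x)"
  unfolding oper_def
  by (auto simp: algebra_simps intro!: cinf_conv_mult[of "\<lambda>_. h" h] cinf_conv_const)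

lemma oper_add: "oper S \<Longrightarrow> oper T \<Longrightarrow> oper (\<lambda>f x. S f x + T f x)"
  unfolding oper_def by (auto simp: algebra_simps intro!: cinf_conv_add)

lemma oper_diff: "oper S \<Longrightarrow> oper T \<Longrightarrow> oper (\<lambda>f x. S f x - T f x)"
  using oper_add[OF _ oper_mult[of "\<lambda>_. -1"]] by fastforce

lemma oper_sum: "(\<And>i. i \<in> I \<Longrightarrow> oper (T i)) \<Longrightarrow> oper (\<lambda>f x. \<Sum>i\<in>I. T i f x)"
  by (induction I rule: infinite_finite_induct) (auto intro: oper_zero oper_add)

lemma oper_apply_zero: "oper T \<Longrightarrow> T (\<lambda>_. 0) = (\<lambda>_. 0)"
  using oper_add_scale[of T "\<lambda>_. 0" "\<lambda>_. 0" "-1"] by simp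

lemma oper_apply_sum:
  assumes "oper T" "\<And>i. i \<in> I \<Longrightarrow> smooth (f i)"
  shows "T (\<lambda>x. \<Sum>i\<in>I. a i * f i x) = (\<lambda>x. \<Sum>i\<in>I. a i * T (f i) x)"
  using assms(2)
proof (induction I rule: infinite_finite_induct)
  case (insert i I)
  have "T (\<lambda>x. (\<Sum>i\<in>I. a i * f i x) + a i * f i x) = (\<lambda>x. T (\<lambda>x. \<Sum>i\<in>I. a i * f i x) x + a i * T (f i) x)"
    using insert.prems by (intro oper_add_scale[OF assms(1)]) auto
  then show ?case using insert by (simp add: add.commute)
qed (simp_all add: oper_apply_zero assms(1))

lemma oper_ext_polyfun:
  assumes S: "oper S" and T: "oper T" and eq: "\<And>w. S (mon w) = T (mon w)" and "polyfun p"
  shows "S p = T p"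
  using assms(4)
proof (induction p rule: polyfun_induct)
  case zero
  show ?case by (simp add: oper_apply_zero S T)
next
  case (add p r w)
  then show ?case by (simp add: oper_add_scale[OF S] oper_add_scale[OF T] smooth_polyfun eq)
qed

lemma oper_ext:
  assumes S: "oper S" and T: "oper T" and eq: "\<And>w. S (mon w) = T (mon w)" and f: "smooth f"
  shows "S f = T f"
proof
  fix x
  obtain p where p: "\<forall>m. polyfun (p m)" "cinf_conv p f" using polynomials_dense[OF f] .
  have sp: "smooth (p m)" for m using p(1) by (simp add: smooth_polyfun)
  have eqp: "S (p m) = T (p m)" for m
    using p(1) by (intro oper_ext_polyfun[OF S T eq]) simp
  have "(\<lambda>m. S (p m) x) \<longlonglongrightarrow> S f x"
    by (rule cinf_conv_pointwise[OF oper_continuous[OF S sp f p(2)]])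
  moreover have "(\<lambda>m. S (p m) x) \<longlonglongrightarrow> T f x"
    unfolding eqp by (rule cinf_conv_pointwise[OF oper_continuous[OF T sp f p(2)]])
  ultimately show "S f x = T f x" by (rule LIMSEQ_unique)
qed

lemma bidiff_oper:
  assumes "bidiff C" "smooth h"
  shows "oper (\<lambda>f. C r f h)" "oper (\<lambda>f. C r h f)"
proof -
  obtain N a where Na: "(\<forall>\<alpha> \<beta>. smooth (a \<alpha> \<beta>)) \<and> (\<forall>f g. smooth f \<longrightarrow> smooth g \<longrightarrow>
        C r f g = (\<lambda>x. \<Sum>\<alpha>\<in>{w. length w \<le> N}. \<Sum>\<beta>\<in>{w. length w \<le> N}. a \<alpha> \<beta> x * dpd \<alpha> f x * dpd \<beta> g x))"
    using spec[OF assms(1)[unfolded bidiff_def], of r] by (elim exE) (rule that)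
  have a: "smooth (a \<alpha> \<beta>)" for \<alpha> \<beta> using Na by simp
  have C: "C r f g = (\<lambda>x. \<Sum>\<alpha>\<in>{w. length w \<le> N}. \<Sum>\<beta>\<in>{w. length w \<le> N}. a \<alpha> \<beta> x * dpd \<alpha> f x * dpd \<beta> g x)"
    if "smooth f" "smooth g" for f g
    using Na that by simp
  have ops: "oper (\<lambda>f x. \<Sum>\<alpha>\<in>{w. length w \<le> N}. \<Sum>\<beta>\<in>{w. length w \<le> N}. (a \<alpha> \<beta> x * dpd \<beta> h x) * dpd \<alpha> f x)"
       "oper (\<lambda>f x. \<Sum>\<alpha>\<in>{w. length w \<le> N}. \<Sum>\<beta>\<in>{w. length w \<le> N}. (a \<alpha> \<beta> x * dpd \<alpha> h x) * dpd \<beta> f x)"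
    by (intro oper_sum oper_mult oper_dpd smooth_mult smooth_dpd a assms(2))+
  show "oper (\<lambda>f. C r f h)"
    by (rule oper_cong[OF ops(1)]) (simp add: C assms(2) ac_simps)
  show "oper (\<lambda>f. C r h f)"
    by (rule oper_cong[OF ops(2)]) (simp add: C assms(2))
qed

section \<open>The linear Poisson bracket\<close>

lemma pb_oper:
  assumes "smooth h"
  shows "oper (pb c h)" "oper (\<lambda>f. pb c f h)"
proof -
  have ops: "oper (\<lambda>f x. \<Sum>i\<in>UNIV. \<Sum>j\<in>UNIV. \<Sum>k\<in>UNIV. (c k i j * (x $ k * pd i h x)) * pd j f x)"
       "oper (\<lambda>f x. \<Sum>i\<in>UNIV. \<Sum>j\<in>UNIV. \<Sum>k\<in>UNIV. (c k i j * (x $ k * pd j h x)) * pd i f x)"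
    by (intro oper_sum oper_mult oper_pd smooth_mult smooth_pd smooth_const smooth_coordinate assms)+
  show "oper (pb c h)"
    by (rule oper_cong[OF ops(1)]) (simp add: pb_def ac_simps)
  show "oper (\<lambda>f. pb c f h)"
    by (rule oper_cong[OF ops(2)]) (simp add: pb_def ac_simps)
qed

lemma hat_eq: "hat x = (\<lambda>\<xi>. \<Sum>i\<in>UNIV. x $ i * mon [i] \<xi>)"
  by (simp add: hat_def inner_vec_def fun_eq_iff)

lemma smooth_hat [simp]: "smooth (hat x)"
  unfolding hat_eq by (intro smooth_sum smooth_mult) auto

lemma pb_leibniz:
  assumes "smooth f" "smooth g" "smooth h"
  shows "pb c (\<lambda>x. f x * g x) h = (\<lambda>x. f x * pb c g h x + pb c f h x * g x)"
    and "pb c h (\<lambda>x. f x * g x) = (\<lambda>x. f x * pb c h g x + pb c h f x * g x)"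
  using assms by (simp_all add: pb_def pd_mult sum_distrib_left sum_distrib_right algebra_simps sum.distrib)

lemma pb_coordinate:
  "pb c (mon [i]) f = (\<lambda>\<xi>. \<Sum>j\<in>UNIV. \<Sum>k\<in>UNIV. \<xi> $ k * c k i j * pd j f \<xi>)"
proof
  fix \<xi>
  have "pb c (mon [i]) f \<xi> = (\<Sum>i'\<in>UNIV. if i' = i then (\<Sum>j\<in>UNIV. \<Sum>k\<in>UNIV. \<xi> $ k * c k i j * pd j f \<xi>) else 0)"
    unfolding pb_def by (rule sum.cong) (auto simp: pd_coordinate)
  then show "pb c (mon [i]) f \<xi> = (\<Sum>j\<in>UNIV. \<Sum>k\<in>UNIV. \<xi> $ k * c k i j * pd j f \<xi>)" by simp
qed

text \<open>Bracketing with a coordinate is a derivation, so it acts on one letter at a time. The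
  same sum over positions arises from commutators in the enveloping algebra.\<close>

lemma pb_coordinate_mon:
  "pb c (mon [i]) (mon w) = (\<lambda>\<xi>. \<Sum>l<length w. \<Sum>k\<in>UNIV. c k i (w ! l) * mon (w[l := k]) \<xi>)"
proof (induction w)
  case Nil
  show ?case unfolding pb_coordinate by (simp add: pd_const)
next
  case (Cons a w)
  have "pb c (mon [i]) (\<lambda>\<xi>. \<xi> $ a) = (\<lambda>\<xi>. \<Sum>k\<in>UNIV. c k i a * \<xi> $ k)"
  proof
    fix \<xi>
    have "pb c (mon [i]) (\<lambda>\<xi>. \<xi> $ a) \<xi> = (\<Sum>j\<in>UNIV. if j = a then (\<Sum>k\<in>UNIV. c k i a * \<xi> $ k) else 0)"
      unfolding pb_coordinate by (rule sum.cong) (auto simp: pd_coordinate mult.commute)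
    then show "pb c (mon [i]) (\<lambda>\<xi>. \<xi> $ a) \<xi> = (\<Sum>k\<in>UNIV. c k i a * \<xi> $ k)" by simp
  qed
  moreover have "pb c (mon [i]) (mon (a # w)) = (\<lambda>\<xi>. \<xi> $ a * pb c (mon [i]) (mon w) \<xi>
      + pb c (mon [i]) (\<lambda>\<xi>. \<xi> $ a) \<xi> * mon w \<xi>)"
    unfolding mon_simps(2)[of a w] by (rule pb_leibniz) auto
  ultimately have "pb c (mon [i]) (mon (a # w)) = (\<lambda>\<xi>.
      (\<Sum>k\<in>UNIV. c k i a * (\<xi> $ k * mon w \<xi>))
      + (\<Sum>l<length w. \<Sum>k\<in>UNIV. c k i (w ! l) * (\<xi> $ a * mon (w[l := k]) \<xi>)))"
    unfolding Cons.IH by (simp add: sum_distrib_left sum_distrib_right ac_simps del: mon_simps(2))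
  then show ?case by (simp only: length_Cons sum.lessThan_Suc_shift) simp
qed

section \<open>The star product on monomials\<close>

lemma mset_coeff_zeroI: "(\<And>u. mset u = M \<Longrightarrow> R u = 0) \<Longrightarrow> mset_coeff M R = 0"
  unfolding mset_coeff_def lin_def by (rule sum.neutral) auto

lemma mset_coeff_sum:
  "(\<And>i. i \<in> I \<Longrightarrow> fin_supp (R i)) \<Longrightarrow> mset_coeff M (\<lambda>u. \<Sum>i\<in>I. R i u) = (\<Sum>i\<in>I. mset_coeff M (R i))"
  unfolding mset_coeff_def by (rule lin_sum)

lemma sg_add_scale:
  "fin_supp A \<Longrightarrow> fin_supp B \<Longrightarrow> sg (\<lambda>u. A u + r * B u) = (\<lambda>w. sg A w + r * sg B w)"
  unfolding sg_def by simp

lemma sg_zero [simp]: "sg (\<lambda>_. 0) = (\<lambda>_. 0)"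
  by (simp add: sg_def)

lemma sg_word [simp]: "sg (word u) = sym_word u"
  by (simp add: sg_def)

lemma sg_sum: "(\<And>i. i \<in> I \<Longrightarrow> fin_supp (R i)) \<Longrightarrow> sg (\<lambda>u. \<Sum>i\<in>I. R i u) = (\<lambda>w. \<Sum>i\<in>I. sg (R i) w)"
  unfolding sg_def by simp

lemma peval_zero [simp]: "peval (\<lambda>_. 0) = (\<lambda>_. 0)"
  by (simp add: peval_eq_lin fun_eq_iff)

lemma peval_word [simp]: "peval (word u) = mon u"
  by (simp add: peval_eq_lin fun_eq_iff)

lemma peval_add_scale:
  "fin_supp A \<Longrightarrow> fin_supp B \<Longrightarrow> peval (\<lambda>u. A u + r * B u) = (\<lambda>\<xi>. peval A \<xi> + r * peval B \<xi>)"
  by (simp add: peval_eq_lin fun_eq_iff)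

lemma sym_word_short:
  assumes "length w \<le> 1"
  shows "sym_word w = word w"
proof -
  have "permute_list \<tau> w = w" if "\<tau> \<in> perms w" for \<tau>
  proof -
    have "mset (permute_list \<tau> w) = mset w" using that by (simp add: perms_def)
    then show ?thesis using assms by (cases w) auto
  qed
  then have "sym_word w u = (\<Sum>\<tau>\<in>perms w. 1 / fact (length w) * word w u)" for u
    unfolding sym_word_eq by (intro sum.cong) auto
  then show ?thesis by (simp add: card_perms fun_eq_iff)
qed

definition homog :: "nat \<Rightarrow> nat \<Rightarrow> ('n list \<Rightarrow> real) \<Rightarrow> bool" where
  "homog N s R \<longleftrightarrow> fin_supp R \<and> (\<forall>u. R u \<noteq> 0 \<longrightarrow> s + length u = N)"

lemma homog_fin_supp: "homog N s R \<Longrightarrow> fin_supp R"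
  by (simp add: homog_def)

lemma homog_mset_coeff: "homog N s R \<Longrightarrow> s + size M \<noteq> N \<Longrightarrow> mset_coeff M R = 0"
  by (rule mset_coeff_zeroI) (auto simp: homog_def)

text \<open>The series \<open>F = \<Sum>\<^sub>s \<nu>\<^sup>s F\<^sub>s\<close> is homogeneous of total degree \<open>N\<close>, where \<open>\<nu>\<close> has degree one,
  and \<open>\<sigma>\<^sub>\<nu>(F) = \<nu>\<^sup>N a\<close> in the enveloping algebra.\<close>

definition represents :: "('n::finite \<Rightarrow> 'n \<Rightarrow> 'n \<Rightarrow> real) \<Rightarrow> nat \<Rightarrow> (nat \<Rightarrow> real^'n \<Rightarrow> real) \<Rightarrow> ('n list \<Rightarrow> real) \<Rightarrow> bool" where
  "represents c N F a \<longleftrightarrow> (\<exists>R. (\<forall>s. homog N s (R s) \<and> F s = peval (R s)) \<and>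
     (\<lambda>w. (\<Sum>s\<le>N. sg (R s) w) - a w) \<in> uideal c)"

lemma represents_zero: "represents c N (\<lambda>s x. 0) (\<lambda>_. 0)"
  unfolding represents_def
  by (rule exI[of _ "\<lambda>_ _. 0"]) (auto simp: homog_def uideal.zero)

lemma represents_add_scale:
  assumes "represents c N F a" "represents c N G b"
  shows "represents c N (\<lambda>s x. F s x + r * G s x) (\<lambda>w. a w + r * b w)"
proof -
  obtain R where R: "\<And>s. homog N s (R s)" "\<And>s. F s = peval (R s)"
    "(\<lambda>w. (\<Sum>s\<le>N. sg (R s) w) - a w) \<in> uideal c"
    using assms(1) unfolding represents_def by blast
  obtain S where S: "\<And>s. homog N s (S s)" "\<And>s. G s = peval (S s)"
    "(\<lambda>w. (\<Sum>s\<le>N. sg (S s) w) - b w) \<in> uideal c"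
    using assms(2) unfolding represents_def by blast
  have fin: "fin_supp (R s)" "fin_supp (S s)" for s using R(1) S(1) homog_fin_supp by blast+
  show ?thesis unfolding represents_def
  proof (intro exI[of _ "\<lambda>s u. R s u + r * S s u"] conjI allI)
    fix s
    have "s + length u = N" if "R s u + r * S s u \<noteq> 0" for u
      using R(1)[of s] S(1)[of s] that unfolding homog_def by (cases "R s u = 0") auto
    then show "homog N s (\<lambda>u. R s u + r * S s u)"
      unfolding homog_def using fin by simp
    show "(\<lambda>x. F s x + r * G s x) = peval (\<lambda>u. R s u + r * S s u)"
      by (simp add: R(2) S(2) peval_add_scale fin)
  next
    show "(\<lambda>w. (\<Sum>s\<le>N. sg (\<lambda>u. R s u + r * S s u) w) - (a w + r * b w)) \<in> uideal c"
      using uideal_add[OF uideal_scale[OF S(3), of r] R(3)]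
      by (simp add: sg_add_scale fin sum.distrib sum_distrib_left algebra_simps)
  qed
qed

lemma represents_diff:
  "represents c N F a \<Longrightarrow> represents c N G b \<Longrightarrow> represents c N (\<lambda>s x. F s x - G s x) (\<lambda>w. a w - b w)"
  using represents_add_scale[of c N F a G b "-1"] by simp

lemma represents_sum:
  "(\<And>i. i \<in> I \<Longrightarrow> represents c N (F i) (a i)) \<Longrightarrow>
    represents c N (\<lambda>s x. \<Sum>i\<in>I. k i * F i s x) (\<lambda>w. \<Sum>i\<in>I. k i * a i w)"
proof (induction I rule: infinite_finite_induct)
  case (insert i I)
  then have "represents c N (\<lambda>s x. (\<Sum>i\<in>I. k i * F i s x) + k i * F i s x) (\<lambda>w. (\<Sum>i\<in>I. k i * a i w) + k i * a i w)"
    by (intro represents_add_scale) auto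
  then show ?case using insert by (simp add: add.commute)
qed (simp_all add: represents_zero)

lemma represents_cong:
  assumes "represents c N F a" "(\<lambda>w. a w - b w) \<in> uideal c"
  shows "represents c N F b"
proof -
  obtain R where R: "\<forall>s. homog N s (R s) \<and> F s = peval (R s)"
    "(\<lambda>w. (\<Sum>s\<le>N. sg (R s) w) - a w) \<in> uideal c"
    using assms(1) unfolding represents_def by blast
  have "(\<lambda>w. (\<Sum>s\<le>N. sg (R s) w) - b w) \<in> uideal c"
    using uideal_add[OF R(2) assms(2)] by simp
  with R(1) show ?thesis unfolding represents_def by blast
qed

lemma represents_mon: "represents c (length u) (cser (mon u)) (sym_word u)"
  unfolding represents_def
proof (intro exI[of _ "\<lambda>s. if s = 0 then word u else (\<lambda>_. 0)"] conjI allI)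
  fix s
  show "homog (length u) s (if s = 0 then word u else (\<lambda>_. 0))"
    by (auto simp: homog_def) (auto simp: word_def split: if_splits)
  show "cser (mon u) s = peval (if s = 0 then word u else (\<lambda>_. 0))"
    by (simp add: cser_def)
next
  have "(\<Sum>s\<le>length u. sg (if s = 0 then word u else (\<lambda>_. 0)) w)
      = (\<Sum>s\<le>length u. if s = 0 then sym_word u w else 0)" for w
    by (rule sum.cong) auto
  then show "(\<lambda>w. (\<Sum>s\<le>length u. sg (if s = 0 then word u else (\<lambda>_. 0)) w) - sym_word u w) \<in> uideal c"
    by (simp add: uideal.zero)
qed

text \<open>Multiplication by nu^r: the total degree grows, the element of the enveloping algebra
  stays the same.\<close>

lemma represents_shift:
  assumes "represents c N F a"
  shows "represents c (N + r) (\<lambda>s. if s < r then (\<lambda>_. 0) else F (s - r)) a"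
proof -
  obtain R where R: "\<And>s. homog N s (R s)" "\<And>s. F s = peval (R s)"
    "(\<lambda>w. (\<Sum>s\<le>N. sg (R s) w) - a w) \<in> uideal c"
    using assms unfolding represents_def by blast
  let ?R = "\<lambda>s. if s < r then (\<lambda>_. 0) else R (s - r)"
  show ?thesis unfolding represents_def
  proof (intro exI[of _ ?R] conjI allI)
    fix s
    show "homog (N + r) s (?R s)" using R(1)[of "s - r"] by (auto simp: homog_def)
    show "(if s < r then \<lambda>_. 0 else F (s - r)) = peval (?R s)" by (simp add: R(2))
  next
    have "(\<Sum>s\<le>N + r. sg (?R s) w) = (\<Sum>s\<in>{r..N + r}. sg (R (s - r)) w)" for w
      by (rule sum.mono_neutral_cong_right) auto
    also have "(\<Sum>s\<in>{r..N + r}. sg (R (s - r)) w) = (\<Sum>s\<le>N. sg (R s) w)" for w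
      by (rule sum.reindex_bij_witness[where i = "\<lambda>s. s + r" and j = "\<lambda>s. s - r"]) auto
    finally show "(\<lambda>w. (\<Sum>s\<le>N + r. sg (?R s) w) - a w) \<in> uideal c" using R(3) by simp
  qed
qed

text \<open>Adding up the orders loses no information: a multiset of size m can only come from order
  \<open>N\<close> - m.\<close>

lemma graded_sg_injective:
  assumes lie: "lie_sc c" and R: "\<And>s. homog N s (R s)"
    and I: "(\<lambda>w. \<Sum>s\<le>N. sg (R s) w) \<in> uideal c"
  shows "mset_coeff M (R s) = 0"
proof (cases "s + size M = N")
  case True
  have fin: "fin_supp (R s)" for s using R homog_fin_supp by blast
  have "mset_coeff M (\<lambda>u. \<Sum>s\<le>N. R s u) = 0"
    using I by (intro sg_injective[OF lie]) (simp_all add: fin sg_sum)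
  also have "mset_coeff M (\<lambda>u. \<Sum>s\<le>N. R s u) = (\<Sum>s'\<le>N. mset_coeff M (R s'))"
    by (rule mset_coeff_sum) (rule fin)
  also have "\<dots> = (\<Sum>s'\<le>N. if s' = s then mset_coeff M (R s) else 0)"
    using True by (intro sum.cong refl) (auto intro: homog_mset_coeff[OF R])
  also have "\<dots> = mset_coeff M (R s)" using True by simp
  finally show ?thesis by simp
qed (rule homog_mset_coeff[OF R])

text \<open>The difference represents 0, so its commutative coefficients vanish in each order.
  Through this, computations in the enveloping algebra become identities of star products.\<close>

lemma represents_unique:
  assumes lie: "lie_sc c" and F: "represents c N F a" and G: "represents c N G a"
  shows "F = G"
proof -
  have "represents c N (\<lambda>s x. F s x - G s x) (\<lambda>_. 0)"
    using represents_diff[OF F G] by simp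
  then obtain R where R: "\<And>s. homog N s (R s)" "\<And>s. (\<lambda>x. F s x - G s x) = peval (R s)"
    "(\<lambda>w. (\<Sum>s\<le>N. sg (R s) w)) \<in> uideal c"
    unfolding represents_def by auto
  have "peval (R s) = (\<lambda>_. 0)" for s
    using homog_fin_supp[OF R(1)] graded_sg_injective[OF lie R(1,3)] by (rule peval_mset_coeff_zero)
  then show ?thesis using R(2) by (simp add: fun_eq_iff)
qed

text \<open>Only order 0 reaches the top degree \<open>N\<close>, where the Poincare-Birkhoff-Witt
  forms read commutative coefficients and ignore the order of the letters in
  \<open>a\<close>.\<close>

lemma represents_leading:
  assumes lie: "lie_sc c" and F: "represents c N F a" and a: "homog N 0 a"
  shows "F 0 = peval a"
proof -
  obtain R where R: "\<And>s. homog N s (R s)" "\<And>s. F s = peval (R s)"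
    "(\<lambda>w. (\<Sum>s\<le>N. sg (R s) w) - a w) \<in> uideal c"
    using F unfolding represents_def by blast
  have fin: "fin_supp (R s)" "fin_supp a" for s using R a homog_fin_supp by blast+
  have "mset_coeff M (\<lambda>u. R 0 u - a u) = 0" for M
  proof (cases "size M = N")
    case False
    then show ?thesis
      using homog_mset_coeff[OF R(1), of 0 M] homog_mset_coeff[OF a, of M] fin
      unfolding mset_coeff_def by simp
  next
    case True
    obtain L where rel: "\<And>u a b v. L (u @ [a, b] @ v) = L (u @ [b, a] @ v) + (\<Sum>k\<in>UNIV. c k a b * L (u @ [k] @ v))"
      and L: "\<And>w. length w \<le> size M \<Longrightarrow> L w = of_bool (mset w = M)"
      by (rule poincare_birkhoff_witt[OF lie, where M = M]) (blast intro: that)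
    have "lin L a = mset_coeff M a"
      unfolding mset_coeff_def using a True by (intro lin_homogeneous_cong L) (auto simp: homog_def)
    moreover have "lin L (sg (R s)) = mset_coeff M (R s)" for s
      unfolding mset_coeff_def lin_sg using R(1)[of s] True
      by (intro lin_homogeneous_cong mset_coeff_sg_leading[OF L]) (auto simp: homog_def)
    moreover have "lin L (\<lambda>w. (\<Sum>s\<le>N. sg (R s) w) - a w) = 0"
      by (rule uideal_lin[OF rel R(3)])
    ultimately have "(\<Sum>s\<le>N. mset_coeff M (R s)) = mset_coeff M a"
      using fin by simp
    moreover have "(\<Sum>s\<le>N. mset_coeff M (R s)) = (\<Sum>s\<le>N. if s = 0 then mset_coeff M (R 0) else 0)"
      using True by (intro sum.cong refl) (auto intro: homog_mset_coeff[OF R(1)])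
    ultimately show ?thesis using fin unfolding mset_coeff_def by simp
  qed
  then have "peval (\<lambda>u. R 0 u - a u) = (\<lambda>_. 0)"
    using fin by (intro peval_mset_coeff_zero) auto
  then show ?thesis using fin by (simp add: R(2) peval_eq_lin fun_eq_iff)
qed

locale bch_product =
  fixes c :: "'n::finite \<Rightarrow> 'n \<Rightarrow> 'n \<Rightarrow> real"
    and C :: "nat \<Rightarrow> (real^'n \<Rightarrow> real) \<Rightarrow> (real^'n \<Rightarrow> real) \<Rightarrow> real^'n \<Rightarrow> real"
  assumes lie: "lie_sc c" and bch: "bch_star c C"
begin

lemma C_oper: "smooth h \<Longrightarrow> oper (\<lambda>f. C r f h)" "smooth h \<Longrightarrow> oper (C r h)"
  using bch bidiff_oper[of C h r] by (simp_all add: bch_star_def)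

text \<open>\<open>bch_poly\<close> does not say that \<open>C r\<close> of two monomials is
  homogeneous. Injectivity does: in every total degree but the expected one the product contributes
  0, so those parts vanish.\<close>

lemma represents_C:
  "represents c (length u + length v) (\<lambda>r. C r (mon u) (mon v)) (wmult (sym_word u) (sym_word v))"
proof -
  let ?N = "length u + length v"
  have "\<exists>R. (\<forall>r. fin_supp (R r) \<and> C r (peval (word u)) (peval (word v)) = peval (R r)) \<and>
       (\<forall>N. (\<lambda>w. (\<Sum>r\<le>N. \<Sum>u | R r u \<noteq> 0 \<and> r + length u = N. R r u * sym_word u w)
              - (\<Sum>(u', v') | word u u' \<noteq> 0 \<and> word v v' \<noteq> 0 \<and> length u' + length v' = N.
                   word u u' * word v v' * wmult (sym_word u') (sym_word v') w)) \<in> uideal c)"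
    using bch unfolding bch_star_def bch_poly_def by (elim conjE allE) (erule mp[OF mp], simp_all)
  then obtain R where R: "\<And>r. fin_supp (R r)" "\<And>r. C r (mon u) (mon v) = peval (R r)"
    and I: "\<And>N. (\<lambda>w. (\<Sum>r\<le>N. \<Sum>u | R r u \<noteq> 0 \<and> r + length u = N. R r u * sym_word u w)
              - (\<Sum>(u', v') | word u u' \<noteq> 0 \<and> word v v' \<noteq> 0 \<and> length u' + length v' = N.
                   word u u' * word v v' * wmult (sym_word u') (sym_word v') w)) \<in> uideal c"
    by auto
  define R' where "R' N r = (\<lambda>u. if r + length u = N then R r u else 0)" for N r
  have fin: "fin_supp (R' N r)" for N r
    using R(1)[of r] unfolding fin_supp_def R'_def by (rule finite_subset[rotated]) auto
  have hom: "homog N r (R' N r)" for N r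
    using fin[of N r] by (auto simp: homog_def R'_def)
  have sgR': "(\<Sum>u | R r u \<noteq> 0 \<and> r + length u = N. R r u * sym_word u w) = sg (R' N r) w" for r N w
    unfolding sg_def lin_def R'_def by (rule sum.cong) auto
  have "{(u', v'). word u u' \<noteq> 0 \<and> word v v' \<noteq> 0 \<and> length u' + length v' = N}
      = (if N = ?N then {(u, v)} else {})" for N
    by (auto simp: word_def)
  then have prod: "(\<Sum>(u', v') | word u u' \<noteq> 0 \<and> word v v' \<noteq> 0 \<and> length u' + length v' = N.
       word u u' * word v v' * wmult (sym_word u') (sym_word v') w)
     = (if N = ?N then wmult (sym_word u) (sym_word v) w else 0)" for N w
    by (simp add: word_def)
  have I': "(\<lambda>w. (\<Sum>r\<le>N. sg (R' N r) w) - (if N = ?N then wmult (sym_word u) (sym_word v) w else 0)) \<in> uideal c" for N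
    using I[of N] unfolding sgR' prod .
  have "mset_coeff M (\<lambda>u. R r u - R' ?N r u) = 0" for M r
  proof (cases "r + size M = ?N")
    case True
    then show ?thesis by (intro mset_coeff_zeroI) (auto simp: R'_def)
  next
    case False
    \<comment> \<open>The total degree in which \<open>M\<close> occurs at order \<open>r\<close>;
      the product of the two words contributes nothing there.\<close>
    let ?K = "r + size M"
    have "mset_coeff M (\<lambda>u. R r u - R' ?K r u) = 0"
      by (intro mset_coeff_zeroI) (auto simp: R'_def)
    moreover have "mset_coeff M (R' ?K r) = 0"
      using I'[of ?K] False by (intro graded_sg_injective[OF lie hom]) simp
    moreover have "mset_coeff M (R' ?N r) = 0"
      using False by (intro homog_mset_coeff[OF hom])
    ultimately show ?thesis using R(1) fin unfolding mset_coeff_def by simp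
  qed
  then have "peval (\<lambda>u. R r u - R' ?N r u) = (\<lambda>_. 0)" for r
    using R(1) fin by (intro peval_mset_coeff_zero) auto
  then have "C r (mon u) (mon v) = peval (R' ?N r)" for r
    using R fin by (simp add: peval_eq_lin fun_eq_iff)
  then show ?thesis
    unfolding represents_def using hom I'[of ?N] by (intro exI[of _ "R' ?N"]) auto
qed

lemma represents_C_homog:
  assumes P: "fin_supp P" "\<And>u. P u \<noteq> 0 \<Longrightarrow> length u = d"
  shows "represents c (d + length v) (\<lambda>r. C r (peval P) (mon v)) (wmult (sg P) (sym_word v))"
    and "represents c (length v + d) (\<lambda>r. C r (mon v) (peval P)) (wmult (sym_word v) (sg P))"
proof -
  have fin: "finite {u. P u \<noteq> 0}" using P by (simp add: fin_supp_def)
  have eq: "peval P = (\<lambda>x. \<Sum>u | P u \<noteq> 0. P u * mon u x)" "sg P = (\<lambda>w. \<Sum>u | P u \<noteq> 0. P u * sym_word u w)"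
    by (simp_all add: peval_eq_lin lin_def sg_def fun_eq_iff)
  have "represents c (d + length v) (\<lambda>r x. \<Sum>u | P u \<noteq> 0. P u * C r (mon u) (mon v) x)
      (\<lambda>w. \<Sum>u | P u \<noteq> 0. P u * wmult (sym_word u) (sym_word v) w)"
    using represents_C P(2) by (intro represents_sum) fastforce
  then show "represents c (d + length v) (\<lambda>r. C r (peval P) (mon v)) (wmult (sg P) (sym_word v))"
    unfolding eq by (simp add: wmult_sum wmult_linear oper_apply_sum[OF C_oper(1)])
  have "represents c (length v + d) (\<lambda>r x. \<Sum>u | P u \<noteq> 0. P u * C r (mon v) (mon u) x)
      (\<lambda>w. \<Sum>u | P u \<noteq> 0. P u * wmult (sym_word v) (sym_word u) w)"
    using represents_C P(2) by (intro represents_sum) fastforce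
  then show "represents c (length v + d) (\<lambda>r. C r (mon v) (peval P)) (wmult (sym_word v) (sg P))"
    unfolding eq by (simp add: wmult_sum wmult_linear oper_apply_sum[OF C_oper(2)])
qed

text \<open>Order \<open>r\<close> of \<open>F\<close> is multiplied as a homogeneous polynomial of
  degree \<open>N - r\<close>, the result is shifted by \<open>r\<close>, and the orders are added
  as in a Cauchy product.\<close>

lemma represents_star_mon:
  assumes F: "represents c N F a" and a: "fin_supp a"
  shows "represents c (N + length v) (\<lambda>s x. \<Sum>r\<le>s. C (s - r) (F r) (mon v) x) (wmult a (sym_word v))"
    and "represents c (length v + N) (\<lambda>s x. \<Sum>r\<le>s. C (s - r) (mon v) (F r) x) (wmult (sym_word v) a)"
proof -
  obtain R where R: "\<And>s. homog N s (R s)" "\<And>s. F s = peval (R s)"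
    "(\<lambda>w. (\<Sum>s\<le>N. sg (R s) w) - a w) \<in> uideal c"
    using F unfolding represents_def by blast
  have fin: "fin_supp (R s)" and len: "R s u \<noteq> 0 \<Longrightarrow> s + length u = N" for s u
    using R(1)[of s] by (auto simp: homog_def)
  \<comment> \<open>Beyond order \<open>N\<close> the degree would be negative; this lets the sum
    over \<open>r\<close> up to \<open>N\<close> be replaced by the one up to
    \<open>s\<close>.\<close>
  have F0: "F r = (\<lambda>_. 0)" if "r > N" for r
  proof -
    have "R r u = 0" for u using len[of r u] that by fastforce
    then have "R r = (\<lambda>_. 0)" by auto
    then show ?thesis by (simp add: R(2))
  qed
  have sum_le: "(\<Sum>r\<le>N. if s < r then 0 else g r) = (\<Sum>r\<le>s. g r)" if "\<And>r. r > N \<Longrightarrow> g r = 0" for s and g :: "nat \<Rightarrow> real"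
    by (rule sum.mono_neutral_cong) (use that in auto)
  have "represents c (N + length v) (\<lambda>s. if s < r then (\<lambda>_. 0) else C (s - r) (F r) (mon v)) (wmult (sg (R r)) (sym_word v))"
    if "r \<le> N" for r
    using represents_shift[OF represents_C_homog(1)[OF fin, of r "N - r" v], of r] len[of r] that
    unfolding R(2) by (fastforce simp: add.commute)
  then have "represents c (N + length v)
      (\<lambda>s x. \<Sum>r\<le>N. 1 * (if s < r then (\<lambda>_. 0) else C (s - r) (F r) (mon v)) x)
      (\<lambda>w. \<Sum>r\<le>N. 1 * wmult (sg (R r)) (sym_word v) w)"
    by (intro represents_sum) auto
  also have "(\<lambda>s x. \<Sum>r\<le>N. 1 * (if s < r then (\<lambda>_. 0) else C (s - r) (F r) (mon v)) x)
      = (\<lambda>s x. \<Sum>r\<le>s. C (s - r) (F r) (mon v) x)"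
    using F0 by (intro ext) (simp add: if_distrib[of "\<lambda>h. h _"] sum_le oper_apply_zero[OF C_oper(1)] cong: if_cong)
  also have "(\<lambda>w. \<Sum>r\<le>N. 1 * wmult (sg (R r)) (sym_word v) w) = wmult (\<lambda>w. \<Sum>r\<le>N. sg (R r) w) (sym_word v)"
    by (simp add: wmult_sum)
  finally show "represents c (N + length v) (\<lambda>s x. \<Sum>r\<le>s. C (s - r) (F r) (mon v) x) (wmult a (sym_word v))"
    using uideal_wmult_right[OF R(3) fin_supp_sym_word, of v]
    by - (rule represents_cong, assumption, simp add: wmult_linear)
  have "represents c (length v + N) (\<lambda>s. if s < r then (\<lambda>_. 0) else C (s - r) (mon v) (F r)) (wmult (sym_word v) (sg (R r)))"
    if "r \<le> N" for r
    using represents_shift[OF represents_C_homog(2)[OF fin, of r "N - r" v], of r] len[of r] that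
    unfolding R(2) by (fastforce simp: add.commute)
  then have "represents c (length v + N)
      (\<lambda>s x. \<Sum>r\<le>N. 1 * (if s < r then (\<lambda>_. 0) else C (s - r) (mon v) (F r)) x)
      (\<lambda>w. \<Sum>r\<le>N. 1 * wmult (sym_word v) (sg (R r)) w)"
    by (intro represents_sum) auto
  also have "(\<lambda>s x. \<Sum>r\<le>N. 1 * (if s < r then (\<lambda>_. 0) else C (s - r) (mon v) (F r)) x)
      = (\<lambda>s x. \<Sum>r\<le>s. C (s - r) (mon v) (F r) x)"
    using F0 by (intro ext) (simp add: if_distrib[of "\<lambda>h. h _"] sum_le oper_apply_zero[OF C_oper(2)] cong: if_cong)
  also have "(\<lambda>w. \<Sum>r\<le>N. 1 * wmult (sym_word v) (sg (R r)) w) = wmult (sym_word v) (\<lambda>w. \<Sum>r\<le>N. sg (R r) w)"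
    by (simp add: wmult_sum)
  finally show "represents c (length v + N) (\<lambda>s x. \<Sum>r\<le>s. C (s - r) (mon v) (F r) x) (wmult (sym_word v) a)"
    using uideal_wmult_left[OF R(3) fin_supp_sym_word, of v]
    by - (rule represents_cong, assumption, simp add: wmult_linear)
qed

section \<open>Associativity, leading term, unit and commutators on monomials\<close>

lemma C_assoc_mon:
  "(\<lambda>x. \<Sum>r\<le>s. C (s - r) (C r (mon u) (mon v)) (mon w) x)
   = (\<lambda>x. \<Sum>r\<le>s. C (s - r) (mon u) (C r (mon v) (mon w)) x)"
proof -
  have "represents c (length u + length v + length w)
      (\<lambda>s x. \<Sum>r\<le>s. C (s - r) (C r (mon u) (mon v)) (mon w) x)
      (wmult (wmult (sym_word u) (sym_word v)) (sym_word w))"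
    by (intro represents_star_mon represents_C) simp
  moreover have "represents c (length u + (length v + length w))
      (\<lambda>s x. \<Sum>r\<le>s. C (s - r) (mon u) (C r (mon v) (mon w)) x)
      (wmult (sym_word u) (wmult (sym_word v) (sym_word w)))"
    by (intro represents_star_mon represents_C) simp
  ultimately show ?thesis
    using represents_unique[OF lie] by (fastforce simp: wmult_assoc add.assoc dest: fun_cong)
qed

lemma C_0_mon: "C 0 (mon u) (mon v) = (\<lambda>x. mon u x * mon v x)"
proof -
  \<comment> \<open>The unreduced product of the symmetrized words is already homogeneous, as
    \<open>represents_leading\<close> requires.\<close>
  have "homog (length u + length v) 0 (wmult (sym_word u) (sym_word v))"
    unfolding homog_def
  proof (intro conjI allI impI)
    fix w assume "wmult (sym_word u) (sym_word v) w \<noteq> 0"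
    then obtain i where "i \<le> length w" "sym_word u (take i w) \<noteq> 0" "sym_word v (drop i w) \<noteq> 0"
      unfolding wmult_def by (metis (no_types, lifting) atMost_iff mult_eq_0_iff sum.not_neutral_contains_not_neutral)
    then have "mset (take i w) = mset u" "mset (drop i w) = mset v" by (auto dest: sym_word_support)
    then have "size (mset (take i w)) + size (mset (drop i w)) = length u + length v" by simp
    then show "0 + length w = length u + length v" using \<open>i \<le> length w\<close> by simp
  qed simp
  from represents_leading[OF lie represents_C this] show ?thesis
    by (simp add: peval_wmult peval_sym_word fun_eq_iff)
qed

text \<open>Both products represent \<open>sym_word v\<close>, which makes constants
  central.\<close>

lemma C_unit_mon: "C s (mon []) (mon v) = C s (mon v) (mon [])"
proof -
  have 1: "sym_word [] = word ([] :: 'n list)" by (rule sym_word_short) simp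
  have "represents c (length v) (\<lambda>r. C r (mon []) (mon v)) (sym_word v)"
    using represents_C[of "[]" v] unfolding 1 by (simp add: wmult_unit del: mon_simps)
  moreover have "represents c (length v) (\<lambda>r. C r (mon v) (mon [])) (sym_word v)"
    using represents_C[of v "[]"] unfolding 1 by (simp add: wmult_unit del: mon_simps)
  ultimately show ?thesis using represents_unique[OF lie] by (metis (no_types, lifting))
qed

text \<open>Moving \<open>i\<close> through \<open>u\<close> letter by letter leaves one bracket for
  each letter passed.\<close>

lemma uideal_commutator:
  "(\<lambda>w. word (i # u @ v) w - word (u @ i # v) w
     - (\<Sum>l<length u. \<Sum>k\<in>UNIV. c k i (u ! l) * word (u[l := k] @ v) w)) \<in> uideal c"
proof (induction u arbitrary: v rule: rev_induct)
  case Nil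
  show ?case by (simp add: uideal.zero)
next
  case (snoc a u)
  have "(\<lambda>w. (\<Sum>l<length (u @ [a]). \<Sum>k\<in>UNIV. c k i ((u @ [a]) ! l) * word ((u @ [a])[l := k] @ v) w))
      = (\<lambda>w. (\<Sum>l<length u. \<Sum>k\<in>UNIV. c k i (u ! l) * word (u[l := k] @ a # v) w)
         + (\<Sum>k\<in>UNIV. c k i a * word (u @ k # v) w))"
    by (auto simp: fun_eq_iff nth_append list_update_append intro!: sum.cong)
  then show ?case
    using uideal_add[OF snoc.IH[of "a # v"] uideal_relator[of u i a v c]] by (simp add: algebra_simps fun_eq_iff)
qed

lemma permute_list_update:
  assumes \<tau>: "\<tau> permutes {..<length w}" and l: "l < length w"
  shows "permute_list \<tau> (w[\<tau> l := k]) = (permute_list \<tau> w)[l := k]"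
proof (rule nth_equalityI)
  fix m assume m: "m < length (permute_list \<tau> (w[\<tau> l := k]))"
  then have "\<tau> m < length w" using \<tau> permutes_in_image by fastforce
  moreover have "\<tau> m = \<tau> l \<longleftrightarrow> m = l" using permutes_inj[OF \<tau>] by (auto dest: injD)
  ultimately show "permute_list \<tau> (w[\<tau> l := k]) ! m = (permute_list \<tau> w)[l := k] ! m"
    using m \<tau> by (auto simp: permute_list_nth nth_list_update)
qed simp

text \<open>Commutation with a generator is a derivation, hence compatible with averaging over the
  positions of the letters.\<close>

lemma uideal_sym_commutator:
  "(\<lambda>w. wmult (word [i]) (sym_word v) w - wmult (sym_word v) (word [i]) w
     - (\<Sum>l<length v. \<Sum>k\<in>UNIV. c k i (v ! l) * sym_word (v[l := k]) w)) \<in> uideal c"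
proof -
  let ?f = "1 / fact (length v) :: real"
  \<comment> \<open>For each permutation the replaced position is renumbered by
    \<open>\<tau>\<close>, which turns replacing before permuting into replacing after it.\<close>
  have D: "(\<Sum>l<length v. \<Sum>k\<in>UNIV. c k i (v ! l) * sym_word (v[l := k]) w)
      = (\<Sum>\<tau>\<in>perms v. ?f * (\<Sum>l<length v. \<Sum>k\<in>UNIV. c k i (permute_list \<tau> v ! l) * word ((permute_list \<tau> v)[l := k]) w))" for w
  proof -
    have "(\<Sum>l<length v. \<Sum>k\<in>UNIV. c k i (v ! l) * sym_word (v[l := k]) w)
        = (\<Sum>l<length v. \<Sum>k\<in>UNIV. \<Sum>\<tau>\<in>perms v. ?f * (c k i (v ! l) * word (permute_list \<tau> (v[l := k])) w))"
      by (simp add: sym_word_eq sum_distrib_left perms_def ac_simps)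
    also have "\<dots> = (\<Sum>\<tau>\<in>perms v. \<Sum>l<length v. \<Sum>k\<in>UNIV. ?f * (c k i (v ! l) * word (permute_list \<tau> (v[l := k])) w))"
      by (subst sum.swap[of _ "perms v"]) (intro sum.cong refl sum.swap)
    also have "\<dots> = (\<Sum>\<tau>\<in>perms v. \<Sum>l<length v. \<Sum>k\<in>UNIV.
        ?f * (c k i (permute_list \<tau> v ! l) * word ((permute_list \<tau> v)[l := k]) w))"
    proof (rule sum.cong[OF refl])
      fix \<tau> assume "\<tau> \<in> perms v"
      then have \<tau>: "\<tau> permutes {..<length v}" by (simp add: perms_def)
      show "(\<Sum>l<length v. \<Sum>k\<in>UNIV. ?f * (c k i (v ! l) * word (permute_list \<tau> (v[l := k])) w))
         = (\<Sum>l<length v. \<Sum>k\<in>UNIV. ?f * (c k i (permute_list \<tau> v ! l) * word ((permute_list \<tau> v)[l := k]) w))"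
        by (subst sum.permute[OF \<tau>])
           (intro sum.cong refl, simp add: permute_list_update[OF \<tau>] permute_list_nth[OF \<tau>])
    qed
    finally show ?thesis by (simp add: sum_distrib_left)
  qed
  have "(\<lambda>w. \<Sum>\<tau>\<in>perms v. ?f * (word (i # permute_list \<tau> v) w - word (permute_list \<tau> v @ [i]) w
     - (\<Sum>l<length v. \<Sum>k\<in>UNIV. c k i (permute_list \<tau> v ! l) * word ((permute_list \<tau> v)[l := k]) w))) \<in> uideal c"
    using uideal_commutator[of i "permute_list _ v" "[]"]
    by (intro uideal_sum uideal_scale) simp
  moreover have "wmult (word [i]) (sym_word v) = (\<lambda>w. \<Sum>\<tau>\<in>perms v. ?f * word (i # permute_list \<tau> v) w)"
    "wmult (sym_word v) (word [i]) = (\<lambda>w. \<Sum>\<tau>\<in>perms v. ?f * word (permute_list \<tau> v @ [i]) w)"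
    unfolding sym_word_eq wmult_sum wmult_linear wmult_word_word by simp_all
  ultimately show ?thesis
    unfolding D by (simp only: right_diff_distrib sum_subtractf)
qed

text \<open>In total degree one plus the length of \<open>v\<close>, the commutator represents a
  combination of symmetrized words of the length of \<open>v\<close>; the missing degree is exactly
  one power of nu.\<close>

lemma C_commutator_mon:
  "(\<lambda>x. C s (mon [i]) (mon v) x - C s (mon v) (mon [i]) x)
   = (if s = 1 then pb c (mon [i]) (mon v) else (\<lambda>_. 0))"
proof -
  have 1: "sym_word [i] = word [i]" by (rule sym_word_short) simp
  have "represents c (1 + length v) (\<lambda>s x. C s (mon [i]) (mon v) x - C s (mon v) (mon [i]) x)
      (\<lambda>w. wmult (word [i]) (sym_word v) w - wmult (sym_word v) (word [i]) w)"
    using represents_diff[OF represents_C[of "[i]" v], of "\<lambda>s. C s (mon v) (mon [i])"] represents_C[of v "[i]"]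
    unfolding 1 by (simp del: mon_simps)
  then have A: "represents c (1 + length v) (\<lambda>s x. C s (mon [i]) (mon v) x - C s (mon v) (mon [i]) x)
      (\<lambda>w. \<Sum>l<length v. \<Sum>k\<in>UNIV. c k i (v ! l) * sym_word (v[l := k]) w)"
    by (rule represents_cong) (rule uideal_sym_commutator)
  have "represents c (length v + 1)
      (\<lambda>s. if s < 1 then (\<lambda>_. 0) else (\<lambda>s x. \<Sum>l<length v. 1 * (\<Sum>k\<in>UNIV. c k i (v ! l) * cser (mon (v[l := k])) s x)) (s - 1))
      (\<lambda>w. \<Sum>l<length v. 1 * (\<Sum>k\<in>UNIV. c k i (v ! l) * sym_word (v[l := k]) w))"
  proof (intro represents_shift represents_sum)
    fix l k
    show "represents c (length v) (cser (mon (v[l := k]))) (sym_word (v[l := k]))"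
      using represents_mon[of c "v[l := k]"] by simp
  qed
  also have "(\<lambda>s. if s < 1 then (\<lambda>_. 0) else (\<lambda>s x. \<Sum>l<length v. 1 * (\<Sum>k\<in>UNIV. c k i (v ! l) * cser (mon (v[l := k])) s x)) (s - 1))
     = (\<lambda>s. if s = 1 then pb c (mon [i]) (mon v) else (\<lambda>_. 0))"
    unfolding pb_coordinate_mon by (auto simp: fun_eq_iff cser_def)
  finally show ?thesis
    using represents_unique[OF lie A] by (simp add: add.commute fun_eq_iff del: mon_simps)
qed

end

section \<open>The star product on smooth functions\<close>

context bch_product
begin

lemma C_smooth [simp]: "smooth f \<Longrightarrow> smooth g \<Longrightarrow> smooth (C r f g)"
  using oper_smooth[OF C_oper(1)] .

lemma C_apply_zero [simp]:
  "smooth f \<Longrightarrow> C r f (\<lambda>_. 0) = (\<lambda>_. 0)" "smooth f \<Longrightarrow> C r (\<lambda>_. 0) f = (\<lambda>_. 0)"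
  using oper_apply_zero[OF C_oper(1)] oper_apply_zero[OF C_oper(2)] by auto

lemma star_cser:
  assumes "smooth f" "smooth g"
  shows "star C (cser f) (cser g) s = C s f g"
proof
  fix x
  have "(\<Sum>b\<le>s - a. C a (cser f b) (cser g (s - a - b)) x) = (if a = s then C s f g x else 0)"
    if "a \<le> s" for a
  proof -
    have "(\<Sum>b\<le>s - a. C a (cser f b) (cser g (s - a - b)) x)
        = (\<Sum>b\<le>s - a. if b = 0 then if a = s then C s f g x else 0 else 0)"
      using that assms by (intro sum.cong refl) (auto simp: cser_def)
    then show ?thesis by simp
  qed
  then have "star C (cser f) (cser g) s x = (\<Sum>a\<le>s. if a = s then C s f g x else 0)"
    unfolding star_def by (intro sum.cong) auto
  then show "star C (cser f) (cser g) s x = C s f g x" by simp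
qed

lemma C_assoc:
  assumes "smooth f" "smooth g" "smooth h"
  shows "(\<Sum>r\<le>s. C (s - r) (C r f g) h x) = (\<Sum>r\<le>s. C (s - r) f (C r g h) x)"
proof -
  let ?L = "\<lambda>f g h x. \<Sum>r\<le>s. C (s - r) (C r f g) h x"
  let ?R = "\<lambda>f g h x. \<Sum>r\<le>s. C (s - r) f (C r g h) x"
  have 1: "oper (?L f g)" "oper (?R f g)" if "smooth f" "smooth g" for f g
  proof -
    show "oper (?L f g)"
      by (rule oper_sum, rule C_oper(2), rule C_smooth[OF that])
    show "oper (?R f g)"
      by (rule oper_sum, rule oper_comp[OF C_oper(2)[OF that(1)] C_oper(2)[OF that(2)]])
  qed
  have 2: "oper (\<lambda>g. ?L f g h)" "oper (\<lambda>g. ?R f g h)" if "smooth f" for f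
  proof -
    show "oper (\<lambda>g. ?L f g h)"
      by (rule oper_sum, rule oper_comp[OF C_oper(1)[OF assms(3)] C_oper(2)[OF that]])
    show "oper (\<lambda>g. ?R f g h)"
      by (rule oper_sum, rule oper_comp[OF C_oper(2)[OF that] C_oper(1)[OF assms(3)]])
  qed
  have 3: "oper (\<lambda>f. ?L f g h)"
    by (rule oper_sum, rule oper_comp[OF C_oper(1)[OF assms(3)] C_oper(1)[OF assms(2)]])
  have 4: "oper (\<lambda>f. ?R f g h)"
    by (rule oper_sum, rule C_oper(1), rule C_smooth[OF assms(2,3)])
  \<comment> \<open>One argument at a time, the third first, then the second and the first, each
    passing from monomials to smooth functions by \<open>oper_ext\<close>.\<close>
  have "?L (mon u) (mon v) h = ?R (mon u) (mon v) h" for u v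
    by (rule oper_ext[OF 1[OF smooth_mon smooth_mon] C_assoc_mon assms(3)])
  from oper_ext[OF 2[OF smooth_mon] this assms(2)] have "?L (mon u) g h = ?R (mon u) g h" for u .
  from oper_ext[OF 3 4 this assms(1)] have "?L f g h = ?R f g h" .
  then show ?thesis by (rule fun_cong)
qed

lemma C_0:
  assumes "smooth f" "smooth g"
  shows "C 0 f g x = f x * g x"
proof -
  have "C 0 (mon u) g = (\<lambda>x. mon u x * g x)" for u
    by (rule oper_ext[OF C_oper(2)[OF smooth_mon] oper_mult[OF smooth_mon oper_id] C_0_mon assms(2)])
  then have "C 0 (mon u) g = (\<lambda>x. g x * mon u x)" for u
    by (simp add: mult.commute)
  from oper_ext[OF C_oper(1)[OF assms(2)] oper_mult[OF assms(2) oper_id] this assms(1)]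
  show ?thesis by (simp add: mult.commute)
qed

text \<open>The coefficient of nu^s in the star commutator of two functions that do not depend on
  nu.\<close>

definition bracket :: "nat \<Rightarrow> (real^'n \<Rightarrow> real) \<Rightarrow> (real^'n \<Rightarrow> real) \<Rightarrow> real^'n \<Rightarrow> real" where
  "bracket s f g = (\<lambda>x. C s f g x - C s g f x)"

lemma bracket_oper: "smooth h \<Longrightarrow> oper (\<lambda>f. bracket s f h)" "smooth h \<Longrightarrow> oper (bracket s h)"
  unfolding bracket_def by (intro oper_diff C_oper; assumption)+

lemma bracket_unit: "smooth g \<Longrightarrow> bracket s (mon []) g = (\<lambda>_. 0)"
  by (rule oper_ext[OF bracket_oper(2)[OF smooth_mon] oper_zero])
     (simp_all add: bracket_def C_unit_mon del: mon_simps)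

lemma bracket_coordinate:
  assumes "smooth g"
  shows "bracket s (mon [i]) g = (if s = 1 then pb c (mon [i]) g else (\<lambda>_. 0))"
proof (cases "s = 1")
  case True
  have "bracket s (mon [i]) g = pb c (mon [i]) g"
    by (rule oper_ext[OF bracket_oper(2)[OF smooth_mon] pb_oper(1)[OF smooth_mon] _ assms])
       (simp only: bracket_def C_commutator_mon True if_True refl)
  with True show ?thesis by simp
next
  case False
  have "bracket s (mon [i]) g = (\<lambda>_. 0)"
    by (rule oper_ext[OF bracket_oper(2)[OF smooth_mon] oper_zero _ assms])
       (simp only: bracket_def C_commutator_mon False if_False)
  with False show ?thesis by simp
qed

text \<open>On the right, (hg)f and h(gf) cancel; the remaining f(hg) and (gf)h are (fh)g and g(fh).
  Each equality is associativity for one cyclic order.\<close>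

lemma bracket_leibniz:
  assumes "smooth f" "smooth h" "smooth g"
  shows "(\<Sum>r\<le>s. bracket (s - r) (C r f h) g x)
    = (\<Sum>r\<le>s. bracket (s - r) f (C r h g) x + bracket (s - r) h (C r g f) x)"
  using C_assoc[OF assms(1,2,3), of s x] C_assoc[OF assms(3,1,2), of s x] C_assoc[OF assms(2,3,1), of s x]
  by (simp add: bracket_def sum.distrib sum_subtractf)

text \<open>Order one of associativity for fhg, gfh and fgh, combined by commutativity of the order
  zero product.\<close>

lemma bracket_1_mult:
  assumes "smooth f" "smooth h" "smooth g"
  shows "bracket 1 (\<lambda>x. f x * h x) g x = f x * bracket 1 h g x + bracket 1 f g x * h x"
proof -
  have prod: "C 0 f h = (\<lambda>x. f x * h x)" "C 0 h g = (\<lambda>x. h x * g x)" "C 0 g h = (\<lambda>x. h x * g x)"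
      "C 0 f g = (\<lambda>x. f x * g x)" "C 0 g f = (\<lambda>x. f x * g x)"
    using assms by (auto simp: C_0)
  have "C 1 (C 0 f h) g x + C 0 (C 1 f h) g x = C 1 f (C 0 h g) x + C 0 f (C 1 h g) x"
    "C 1 (C 0 g f) h x + C 0 (C 1 g f) h x = C 1 g (C 0 f h) x + C 0 g (C 1 f h) x"
    "C 1 (C 0 f g) h x + C 0 (C 1 f g) h x = C 1 f (C 0 g h) x + C 0 f (C 1 g h) x"
    using C_assoc[OF assms(1,2,3), of 1 x] C_assoc[OF assms(3,1,2), of 1 x] C_assoc[OF assms(1,3,2), of 1 x]
    by simp_all
  then show ?thesis
    unfolding prod using assms by (simp add: bracket_def C_0 algebra_simps)
qed

text \<open>Both sides are derivations in \<open>f\<close> that agree on coordinates, hence on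
  monomials.\<close>

lemma bracket_1:
  assumes "smooth f" "smooth g"
  shows "bracket 1 f g = pb c f g"
proof -
  have "bracket 1 (mon w) g = pb c (mon w) g" for w
  proof (induction w)
    case Nil
    show ?case using bracket_unit[OF assms(2), of 1] by (simp add: pb_def pd_const)
  next
    case (Cons i w)
    have eq: "mon (i # w) = (\<lambda>\<xi>. mon [i] \<xi> * mon w \<xi>)" by simp
    have "bracket 1 (mon (i # w)) g x = pb c (mon (i # w)) g x" for x
      unfolding eq bracket_1_mult[OF smooth_mon smooth_mon assms(2)]
        pb_leibniz(1)[OF smooth_mon smooth_mon assms(2)] Cons.IH bracket_coordinate[OF assms(2)]
      by simp
    then show ?case by (rule ext)
  qed
  from oper_ext[OF bracket_oper(1)[OF assms(2)] pb_oper(2)[OF assms(2)] this assms(1)]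
  show ?thesis .
qed

lemma bracket_hat:
  assumes "smooth g"
  shows "bracket s (hat x) g = (if s = 1 then pb c (hat x) g else (\<lambda>_. 0))"
proof -
  have "bracket s (hat x) g = (\<lambda>\<xi>. \<Sum>i\<in>UNIV. x $ i * bracket s (mon [i]) g \<xi>)"
    unfolding hat_eq by (rule oper_apply_sum[OF bracket_oper(1)[OF assms]]) (rule smooth_mon)
  moreover have "pb c (hat x) g = (\<lambda>\<xi>. \<Sum>i\<in>UNIV. x $ i * pb c (mon [i]) g \<xi>)"
    unfolding hat_eq by (rule oper_apply_sum[OF pb_oper(2)[OF assms]]) (rule smooth_mon)
  ultimately show ?thesis
    unfolding bracket_coordinate[OF assms] by simp
qed

lemma comm_cser:
  "smooth f \<Longrightarrow> smooth g \<Longrightarrow> comm C (cser f) (cser g) s = bracket s f g"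
  by (simp add: comm_def bracket_def star_cser fun_eq_iff)

lemma comm_eq_bracket:
  "comm C F G s = (\<lambda>x. \<Sum>a\<le>s. \<Sum>b\<le>s - a. bracket a (F b) (G (s - a - b)) x)"
proof
  fix x
  have "(\<Sum>b\<le>s - a. C a (G b) (F (s - a - b)) x) = (\<Sum>b\<le>s - a. C a (G (s - a - b)) (F b) x)" for a
    by (rule sum.reindex_bij_witness[where i = "\<lambda>b. s - a - b" and j = "\<lambda>b. s - a - b"])
       (simp_all only: atMost_iff diff_diff_cancel diff_le_self)
  then show "comm C F G s x = (\<Sum>a\<le>s. \<Sum>b\<le>s - a. bracket a (F b) (G (s - a - b)) x)"
    by (simp add: comm_def star_def bracket_def sum_subtractf)
qed

end

section \<open>Invariant functionals are traces\<close>

text \<open>A single coefficient \<open>\<tau> r\<close>, with all hypotheses phrased for functions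
  and the operators \<open>C s\<close> instead of series.\<close>

locale invariant_functional = bch_product c C
  for c :: "'n::finite \<Rightarrow> 'n \<Rightarrow> 'n \<Rightarrow> real" and C +
  fixes D :: "(real^'n \<Rightarrow> real) set" and T :: "(real^'n \<Rightarrow> real) \<Rightarrow> real"
  assumes D_smooth: "g \<in> D \<Longrightarrow> smooth g"
    and D_zero: "(\<lambda>_. 0) \<in> D"
    and D_add_scale: "f \<in> D \<Longrightarrow> g \<in> D \<Longrightarrow> (\<lambda>x. f x + a * g x) \<in> D"
    and D_ideal: "smooth f \<Longrightarrow> g \<in> D \<Longrightarrow> C s f g \<in> D" "smooth f \<Longrightarrow> g \<in> D \<Longrightarrow> C s g f \<in> D"
    and T_add_scale: "f \<in> D \<Longrightarrow> g \<in> D \<Longrightarrow> T (\<lambda>x. f x + a * g x) = T f + a * T g"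
    and T_continuous: "smooth f \<Longrightarrow> g \<in> D \<Longrightarrow> \<forall>m. polyfun (p m) \<Longrightarrow> cinf_conv p f \<Longrightarrow>
        (\<lambda>m. T (bracket s (p m) g)) \<longlonglongrightarrow> T (bracket s f g)"
    and T_invariant: "g \<in> D \<Longrightarrow> T (pb c (mon [i]) g) = 0"
begin

lemma T_zero: "T (\<lambda>_. 0) = 0"
  using T_add_scale[OF D_zero D_zero, of "-1"] by simp

lemma D_sum: "(\<And>i. i \<in> I \<Longrightarrow> f i \<in> D) \<Longrightarrow> (\<lambda>x. \<Sum>i\<in>I. f i x) \<in> D"
proof (induction I rule: infinite_finite_induct)
  case (insert i I)
  then show ?case using D_add_scale[of "f i" "\<lambda>x. \<Sum>i\<in>I. f i x" 1] by simp
qed (simp_all add: D_zero)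

lemma T_sum: "(\<And>i. i \<in> I \<Longrightarrow> f i \<in> D) \<Longrightarrow> T (\<lambda>x. \<Sum>i\<in>I. f i x) = (\<Sum>i\<in>I. T (f i))"
proof (induction I rule: infinite_finite_induct)
  case (insert i I)
  then show ?case using T_add_scale[of "f i" "\<lambda>x. \<Sum>i\<in>I. f i x" 1] D_sum[of I f] by simp
qed (simp_all add: T_zero)

lemma bracket_in_D: "smooth f \<Longrightarrow> g \<in> D \<Longrightarrow> bracket s f g \<in> D"
  using D_add_scale[OF D_ideal, of f g f g s "-1" s] by (simp add: bracket_def)

lemma T_bracket_add_scale:
  assumes "smooth f" "smooth h" "g \<in> D"
  shows "T (bracket s (\<lambda>x. f x + a * h x) g) = T (bracket s f g) + a * T (bracket s h g)"
  using assms by (simp add: oper_add_scale[OF bracket_oper(1)] D_smooth T_add_scale bracket_in_D)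

lemma T_bracket_peval:
  assumes "fin_supp P" "\<And>u. P u \<noteq> 0 \<Longrightarrow> T (bracket s (mon u) g) = 0" "g \<in> D"
  shows "T (bracket s (peval P) g) = 0"
proof -
  have "T (bracket s (\<lambda>x. \<Sum>u\<in>S. P u * mon u x) g) = 0" if "finite S" "S \<subseteq> {u. P u \<noteq> 0}" for S
    using that
  proof (induction S)
    case empty
    then show ?case using oper_apply_zero[OF bracket_oper(1)] assms(3) by (simp add: D_smooth T_zero)
  next
    case (insert u S)
    have "T (bracket s (\<lambda>x. (\<Sum>u\<in>S. P u * mon u x) + P u * mon u x) g)
        = T (bracket s (\<lambda>x. \<Sum>u\<in>S. P u * mon u x) g) + P u * T (bracket s (mon u) g)"
      using assms(3) by (intro T_bracket_add_scale) auto
    then show ?case using insert assms(2)[of u] by (simp add: add.commute)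
  qed
  moreover have "peval P = (\<lambda>x. \<Sum>u | P u \<noteq> 0. P u * mon u x)"
    by (simp add: peval_eq_lin lin_def fun_eq_iff)
  ultimately show ?thesis using assms(1) by (simp add: fin_supp_def)
qed

text \<open>By the Leibniz rule \<open>[\<xi>\<^sub>i \<star> h, g] = [\<xi>\<^sub>i, h \<star> g] + [h, g \<star> \<xi>\<^sub>i]\<close>, and
  \<open>\<xi>\<^sub>i \<star> \<xi>\<^sup>w\<close> differs from the monomial \<open>\<xi>\<^sub>i \<xi>\<^sup>w\<close> by polynomials of degree at most \<open>|w|\<close>.\<close>

lemma T_bracket_mon: "g \<in> D \<Longrightarrow> T (bracket s (mon w) g) = 0"
\<comment> \<open>\<open>g\<close> and \<open>s\<close> stay arbitrary: the hypothesis is applied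
  with \<open>C r g ?X\<close> in place of \<open>g\<close>, and at other orders.\<close>
proof (induction "length w" arbitrary: w g s rule: less_induct)
  case less
  show ?case
  proof (cases w)
    case Nil
    then show ?thesis using bracket_unit[OF D_smooth[OF less.prems], of s] by (simp add: T_zero)
  next
    case (Cons i w')
    note g = D_smooth[OF less.prems]
    let ?X = "mon [i] :: real^'n \<Rightarrow> real" and ?W = "mon w' :: real^'n \<Rightarrow> real"
    have "represents c (length [i] + length w') (\<lambda>r. C r ?X ?W) (wmult (sym_word [i]) (sym_word w'))"
      by (rule represents_C)
    then obtain R where R: "\<And>r. homog (Suc (length w')) r (R r)" "\<And>r. C r ?X ?W = peval (R r)"
      unfolding represents_def by auto
    \<comment> \<open>Homogeneity lowers the degree by \<open>r\<close>, so for nonzero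
      \<open>r\<close> only monomials shorter than \<open>w\<close> occur.\<close>
    have lower: "T (bracket t (C r ?X ?W) g) = 0" if "r \<noteq> 0" for r t
      unfolding R(2) using R(1)[of r] that Cons less.prems
      by (intro T_bracket_peval less.hyps) (auto simp: homog_def)
    have invariant: "T (bracket t ?X h) = 0" if "h \<in> D" for t h
      using that by (simp add: bracket_coordinate D_smooth T_invariant T_zero del: mon_simps)
    have "T (\<lambda>x. \<Sum>r\<le>s. bracket (s - r) (C r ?X ?W) g x)
        = T (\<lambda>x. \<Sum>r\<le>s. (\<lambda>x. bracket (s - r) ?X (C r ?W g) x + 1 * bracket (s - r) ?W (C r g ?X) x) x)"
      by (simp only: bracket_leibniz[OF smooth_mon smooth_mon g] mult_1)
    also have "\<dots> = (\<Sum>r\<le>s. T (\<lambda>x. bracket (s - r) ?X (C r ?W g) x + 1 * bracket (s - r) ?W (C r g ?X) x))"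
      using less.prems by (intro T_sum D_add_scale bracket_in_D D_ideal) (auto simp del: mon_simps)
    also have "\<dots> = (\<Sum>r\<le>s. T (bracket (s - r) ?X (C r ?W g)) + 1 * T (bracket (s - r) ?W (C r g ?X)))"
      using less.prems by (intro sum.cong refl T_add_scale bracket_in_D D_ideal) (auto simp del: mon_simps)
    also have "\<dots> = 0"
      using less.prems less.hyps[of w'] Cons by (simp add: invariant D_ideal del: mon_simps)
    finally have "0 = T (\<lambda>x. \<Sum>r\<le>s. bracket (s - r) (C r ?X ?W) g x)" by simp
    also have "\<dots> = (\<Sum>r\<le>s. T (bracket (s - r) (C r ?X ?W) g))"
      using less.prems by (intro T_sum bracket_in_D) (auto simp del: mon_simps)
    \<comment> \<open>Only order 0 of the inner product survives, and there it is the monomial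
      itself.\<close>
    also have "\<dots> = (\<Sum>r\<le>s. if r = 0 then T (bracket s (mon w) g) else 0)"
    proof (intro sum.cong refl)
      fix r assume "r \<in> {..s}"
      have "C 0 ?X ?W = mon w" using C_0_mon[of "[i]" w'] by (simp add: Cons)
      then show "T (bracket (s - r) (C r ?X ?W) g) = (if r = 0 then T (bracket s (mon w) g) else 0)"
        using lower[of r "s - r"] by (cases "r = 0") (simp_all del: mon_simps)
    qed
    finally show ?thesis by simp
  qed
qed

text \<open>Density is used in \<open>f\<close> alone with \<open>g\<close> fixed, as the continuity
  hypothesis allows.\<close>

lemma T_bracket:
  assumes f: "smooth f" and g: "g \<in> D"
  shows "T (bracket s f g) = 0"
proof -
  obtain p where p: "\<forall>m. polyfun (p m)" "cinf_conv p f" using polynomials_dense[OF f] .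
  have "T (bracket s (p m) g) = 0" for m
    using p(1) unfolding polyfun_def by (metis T_bracket_peval T_bracket_mon g)
  then have "(\<lambda>m. T (bracket s (p m) g)) \<longlonglongrightarrow> 0" by simp
  then show ?thesis using T_continuous[OF f g p] LIMSEQ_unique by blast
qed

lemma T_comm:
  assumes "\<And>s. smooth (F s)" "\<And>s. G s \<in> D"
  shows "T (comm C F G s) = 0"
proof -
  have B: "bracket a (F b) (G e) \<in> D" for a b e using assms by (rule bracket_in_D)
  have "T (comm C F G s) = (\<Sum>a\<le>s. T (\<lambda>x. \<Sum>b\<le>s - a. bracket a (F b) (G (s - a - b)) x))"
    unfolding comm_eq_bracket by (intro T_sum D_sum B)
  also have "\<dots> = (\<Sum>a\<le>s. \<Sum>b\<le>s - a. T (bracket a (F b) (G (s - a - b))))"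
    by (intro sum.cong refl T_sum B)
  finally show ?thesis using assms by (simp add: T_bracket)
qed

end

theorem theorem4p1:
  fixes c :: "'n::finite \<Rightarrow> 'n \<Rightarrow> 'n \<Rightarrow> real"
    and C :: "nat \<Rightarrow> (real^'n \<Rightarrow> real) \<Rightarrow> (real^'n \<Rightarrow> real) \<Rightarrow> real^'n \<Rightarrow> real"
    and D :: "(real^'n \<Rightarrow> real) set"
    and \<tau> :: "nat \<Rightarrow> (real^'n \<Rightarrow> real) \<Rightarrow> real"
  assumes lie: "lie_sc c"
    and bch: "bch_star c C"
    and D_smooth: "D \<subseteq> {f. smooth f}"
    and D_zero: "(\<lambda>_. 0) \<in> D"
    and D_add: "\<forall>f\<in>D. \<forall>g\<in>D. (\<lambda>x. f x + g x) \<in> D"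
    and D_scale: "\<forall>a. \<forall>f\<in>D. (\<lambda>x. a * f x) \<in> D"
    and D_ideal: "\<forall>F G. (\<forall>s. smooth (F s)) \<longrightarrow> (\<forall>s. G s \<in> D) \<longrightarrow>
                    (\<forall>s. star C F G s \<in> D \<and> star C G F s \<in> D)"
    and \<tau>_lin: "\<forall>r a b. \<forall>f\<in>D. \<forall>g\<in>D. \<tau> r (\<lambda>x. a * f x + b * g x) = a * \<tau> r f + b * \<tau> r g"
    and \<tau>_cont: "\<forall>f g p. smooth f \<longrightarrow> g \<in> D \<longrightarrow> (\<forall>m. polyfun (p m)) \<longrightarrow> cinf_conv p f \<longrightarrow>
                  (\<forall>r s. (\<lambda>m. \<tau> r (comm C (cser (p m)) (cser g) s))
                          \<longlonglongrightarrow> \<tau> r (comm C (cser f) (cser g) s))"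
  shows "((\<forall>F G. (\<forall>s. smooth (F s)) \<longrightarrow> (\<forall>s. G s \<in> D) \<longrightarrow>
              (\<forall>N. (\<Sum>r\<le>N. \<tau> r (comm C F G (N - r))) = 0))
          \<longleftrightarrow> (\<forall>r f g. smooth f \<longrightarrow> g \<in> D \<longrightarrow> \<tau> r (pb c f g) = 0))
       \<and> ((\<forall>r f g. smooth f \<longrightarrow> g \<in> D \<longrightarrow> \<tau> r (pb c f g) = 0)
          \<longleftrightarrow> (\<forall>r x g. g \<in> D \<longrightarrow> \<tau> r (pb c (hat x) g) = 0))"
proof -
  interpret bch_product c C by unfold_locales (fact lie bch)+
  have sm: "smooth g" if "g \<in> D" for g using D_smooth that by auto
  have cser_D: "cser g s \<in> D" if "g \<in> D" for g s using that D_zero by (simp add: cser_def)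
  have cser_smooth: "smooth (cser f s)" if "smooth f" for f :: "real^'n \<Rightarrow> real" and s
    using that by (simp add: cser_def)
  \<comment> \<open>For series constant in nu, the orders of the star product are the operators
    \<open>C s\<close> themselves.\<close>
  have ideal: "C s f g \<in> D" "C s g f \<in> D" if "smooth f" "g \<in> D" for s f g
    using D_ideal[rule_format, of "cser f" "cser g"] cser_smooth[OF that(1)] cser_D[OF that(2)]
    by (simp_all add: star_cser sm that)
  have \<tau>_zero: "\<tau> r (\<lambda>_. 0) = 0" for r
    using \<tau>_lin[rule_format, OF D_zero D_zero, of r 0 0] by simp
  let ?trace = "\<forall>F G. (\<forall>s. smooth (F s)) \<longrightarrow> (\<forall>s. G s \<in> D) \<longrightarrow>
      (\<forall>N. (\<Sum>r\<le>N. \<tau> r (comm C F G (N - r))) = 0)"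
  let ?poisson = "\<forall>r f g. smooth f \<longrightarrow> g \<in> D \<longrightarrow> \<tau> r (pb c f g) = 0"
  let ?invariant = "\<forall>r x g. g \<in> D \<longrightarrow> \<tau> r (pb c (hat x) g) = 0"
  have "?trace \<and> ?poisson" if inv: ?invariant
  proof -
    have "invariant_functional c C D (\<tau> r)" for r
    proof unfold_locales
      fix f g a assume fg: "f \<in> D" "g \<in> D"
      show "(\<lambda>x. f x + a * g x) \<in> D" using D_add D_scale fg by simp
      show "\<tau> r (\<lambda>x. f x + a * g x) = \<tau> r f + a * \<tau> r g"
        using \<tau>_lin[rule_format, OF fg, of r 1 a] by simp
    next
      fix f g :: "real^'n \<Rightarrow> real" and p s assume *: "smooth f" "g \<in> D" "\<forall>m. polyfun (p m)" "cinf_conv p f"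
      then show "(\<lambda>m. \<tau> r (bracket s (p m) g)) \<longlonglongrightarrow> \<tau> r (bracket s f g)"
        using \<tau>_cont[rule_format, of f g p r s] by (simp add: comm_cser sm smooth_polyfun)
    next
      fix g and i :: 'n assume "g \<in> D"
      moreover have "mon [i] = hat (axis i 1)"
        by (simp add: hat_def inner_axis' fun_eq_iff)
      ultimately show "\<tau> r (pb c (mon [i]) g) = 0" using inv by simp
    qed (auto simp: sm ideal D_zero)
    note T = invariant_functional.T_comm[OF this] and T' = invariant_functional.T_bracket[OF this]
    have ?trace using T by (intro allI impI sum.neutral ballI) blast
    moreover have ?poisson
    proof (intro allI impI)
      fix r and f g :: "real^'n \<Rightarrow> real" assume "smooth f" "g \<in> D"
      then show "\<tau> r (pb c f g) = 0" using T'[of f g r 1] by (simp only: bracket_1 sm)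
    qed
    ultimately show ?thesis ..
  qed
  moreover have ?invariant if ?trace
  proof (intro allI impI)
    fix r x g assume g: "g \<in> D"
    \<comment> \<open>Order \<open>Suc r\<close> of the trace condition is the right one:
      commutators with \<open>hat x\<close> live in order one, so only the summand
      \<open>q = r\<close> survives.\<close>
    have "0 = (\<Sum>q\<le>Suc r. \<tau> q (comm C (cser (hat x)) (cser g) (Suc r - q)))"
      by (rule that[rule_format, OF cser_smooth[OF smooth_hat] cser_D[OF g], symmetric])
    also have "\<dots> = (\<Sum>q\<le>Suc r. if q = r then \<tau> r (pb c (hat x) g) else 0)"
      by (intro sum.cong refl) (auto simp: comm_cser bracket_hat sm g \<tau>_zero)
    finally show "\<tau> r (pb c (hat x) g) = 0" by simp
  qed
  moreover have ?invariant if ?poisson using that by simp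
  ultimately show ?thesis by blast
qed

end
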